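(* Let $G$ be a bridgeless cubic graph with oddness $\omega=\omega(G)$. If $m_G^* \geq \frac{5}{2}\omega - 1$, then $G$ has a nowhere-zero $5$-flow.
   Context: Graphs may have multiple edges but no loops. An orientation $D$ of a graph $M=(V,E)$ assigns a direction to each edge; for $v\in V$, $D^+(v)$ ($D^-(v)$) is the set of edges whose tail (head) is $v$. For an integer $k\ge 2$, a $k$-flow on $M$ is a pair $(D,\varphi)$ with $\varphi:E\to\{0,1,\dots,k-1\}$ such that $\sum_{e\in D^+(v)}\varphi(e)=\sum_{e\in D^-(v)}\varphi(e)$ for every $v\in V$; it is nowhere-zero if $\varphi(e)\neq 0$ for all $e$. The oddness $\omega(G)$ of a bridgeless cubic graph $G$ is the minimum number of odd cycles in a 2-factor of $G$; a minimum 2-factor is a 2-factor with exactly $\omega(G)$ odd cycles. For a minimum 2-factor $\mathcal{F}_2$ of $G=(V,E)$: if $\omega(G)\ge 2$, $m_G(\mathcal{F}_2)$ is the maximum number $k$ such that there is no edge cut $E'\subset E$ with fewer than $k$ edges such that two components of $G-E'$ contain odd cycles of $\mathcal{F}_2$; if $\omega(G)=0$, $m_G(\mathcal{F}_2)=\infty$. Finally $m_G^*=\max\{m_G(\mathcal{F}_2) : \mathcal{F}_2 \text{ a minimum 2-factor of } G\}$. *)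

theory Defs
  imports "Graph_Theory.Digraph" "HOL-Library.Extended_Real"
begin

record ('v, 'e) mgraph =
  vertices :: "'v set"
  edges :: "'e set"
  ends :: "'e \<Rightarrow> 'v set"

(* Two-element end sets exclude loops; distinct edges may have the same ends. *)
locale multigraph =
  fixes G :: "('v, 'e) mgraph"
  assumes finite_vertices: "finite (vertices G)"
    and finite_edges: "finite (edges G)"
    and ends_subset: "e \<in> edges G \<Longrightarrow> ends G e \<subseteq> vertices G"
    and card_ends: "e \<in> edges G \<Longrightarrow> card (ends G e) = 2"

definition degree :: "('v, 'e) mgraph \<Rightarrow> 'v \<Rightarrow> nat" where
  "degree G v = card {e \<in> edges G. v \<in> ends G e}"

definition regular :: "nat \<Rightarrow> ('v, 'e) mgraph \<Rightarrow> bool" where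
  "regular d G \<longleftrightarrow> (\<forall>v\<in>vertices G. degree G v = d)"

abbreviation cubic :: "('v, 'e) mgraph \<Rightarrow> bool" where
  "cubic \<equiv> regular 3"

definition adjacency :: "('v, 'e) mgraph \<Rightarrow> ('v \<times> 'v) set" where
  "adjacency G = {(u, v). \<exists>e\<in>edges G. ends G e = {u, v}}"

definition delete_edges :: "('v, 'e) mgraph \<Rightarrow> 'e set \<Rightarrow> ('v, 'e) mgraph" where
  "delete_edges G E' = G\<lparr>edges := edges G - E'\<rparr>"

definition bridge :: "('v, 'e) mgraph \<Rightarrow> 'e \<Rightarrow> bool" where
  "bridge G e \<longleftrightarrow> e \<in> edges G \<and>
     (\<exists>u v. ends G e = {u, v} \<and> (u, v) \<notin> (adjacency (delete_edges G {e}))\<^sup>*)"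

definition bridgeless :: "('v, 'e) mgraph \<Rightarrow> bool" where
  "bridgeless G \<longleftrightarrow> (\<forall>e. \<not> bridge G e)"

(* All subgraphs of G carry the same function ends, so that equality of
   records is equality of subgraphs. *)
definition subgraph :: "('v, 'e) mgraph \<Rightarrow> ('v, 'e) mgraph \<Rightarrow> bool" where
  "subgraph H G \<longleftrightarrow> vertices H \<subseteq> vertices G \<and> edges H \<subseteq> edges G \<and> ends H = ends G
     \<and> (\<forall>e\<in>edges H. ends H e \<subseteq> vertices H)"

definition induced :: "('v, 'e) mgraph \<Rightarrow> 'v set \<Rightarrow> ('v, 'e) mgraph" where
  "induced G W = G\<lparr>vertices := W, edges := {e \<in> edges G. ends G e \<subseteq> W}\<rparr>"

definition components :: "('v, 'e) mgraph \<Rightarrow> ('v, 'e) mgraph set" where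
  "components G = (\<lambda>u. induced G {v. (u, v) \<in> (adjacency G)\<^sup>*}) ` vertices G"

definition two_factor :: "('v, 'e) mgraph \<Rightarrow> ('v, 'e) mgraph \<Rightarrow> bool" where
  "two_factor G F \<longleftrightarrow> subgraph F G \<and> vertices F = vertices G \<and> regular 2 F"

(* The cycles of a 2-factor are its components; two parallel edges form a
   cycle of length 2. *)
definition odd_cycles :: "('v, 'e) mgraph \<Rightarrow> ('v, 'e) mgraph set" where
  "odd_cycles F = {C \<in> components F. odd (card (edges C))}"

(* Extended naturals: the value is \<infinity> exactly when G has no 2-factor, which does
   not happen for bridgeless cubic graphs. *)
definition oddness :: "('v, 'e) mgraph \<Rightarrow> enat" where
  "oddness G = (INF F\<in>{F. two_factor G F}. enat (card (odd_cycles F)))"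

definition minimum_two_factor :: "('v, 'e) mgraph \<Rightarrow> ('v, 'e) mgraph \<Rightarrow> bool" where
  "minimum_two_factor G F \<longleftrightarrow> two_factor G F \<and> enat (card (odd_cycles F)) = oddness G"

definition edge_cut :: "('v, 'e) mgraph \<Rightarrow> 'e set \<Rightarrow> bool" where
  "edge_cut G E' \<longleftrightarrow> (\<exists>S. S \<noteq> {} \<and> S \<subset> vertices G \<and>
     E' = {e \<in> edges G. ends G e \<inter> S \<noteq> {} \<and> ends G e - S \<noteq> {}})"

definition separates_odd_cycles ::
    "('v, 'e) mgraph \<Rightarrow> ('v, 'e) mgraph \<Rightarrow> 'e set \<Rightarrow> bool" where
  "separates_odd_cycles G F E' \<longleftrightarrow>
     (\<exists>K1\<in>components (delete_edges G E'). \<exists>K2\<in>components (delete_edges G E').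
        K1 \<noteq> K2 \<and> (\<exists>C\<in>odd_cycles F. subgraph C K1) \<and> (\<exists>C\<in>odd_cycles F. subgraph C K2))"

(* If G is cubic and F has an odd cycle, the supremum is a maximum: F has at
   least two odd cycles (their number is even), and the edges leaving the vertex set of one of them form
   an edge cut separating it from the others. *)
definition m_of :: "('v, 'e) mgraph \<Rightarrow> ('v, 'e) mgraph \<Rightarrow> enat" where
  "m_of G F = (if oddness G = 0 then \<infinity>
     else Sup {enat k | k. \<not> (\<exists>E'. edge_cut G E' \<and> card E' < k \<and> separates_odd_cycles G F E')})"

definition m_star :: "('v, 'e) mgraph \<Rightarrow> enat" where
  "m_star G = (SUP F\<in>{F. minimum_two_factor G F}. m_of G F)"

definition orientation :: "('v, 'e) mgraph \<Rightarrow> ('v, 'e) pre_digraph \<Rightarrow> bool" where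
  "orientation G D \<longleftrightarrow> verts D = vertices G \<and> arcs D = edges G
     \<and> (\<forall>e\<in>edges G. ends G e = {tail D e, head D e})"

definition is_flow ::
    "nat \<Rightarrow> ('v, 'e) mgraph \<Rightarrow> ('v, 'e) pre_digraph \<Rightarrow> ('e \<Rightarrow> nat) \<Rightarrow> bool" where
  "is_flow k G D \<phi> \<longleftrightarrow> orientation G D \<and> (\<forall>e\<in>edges G. \<phi> e < k)
     \<and> (\<forall>v\<in>vertices G. (\<Sum>e\<in>out_arcs D v. \<phi> e) = (\<Sum>e\<in>in_arcs D v. \<phi> e))"

definition has_nowhere_zero_flow :: "nat \<Rightarrow> ('v, 'e) mgraph \<Rightarrow> bool" where
  "has_nowhere_zero_flow k G \<longleftrightarrow>
     (\<exists>D \<phi>. is_flow k G D \<phi> \<and> (\<forall>e\<in>edges G. \<phi> e \<noteq> 0))"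

end

theory Submission
  imports Defs "HOL-Combinatorics.Orbits"
begin

text \<open>
  Let \<open>F\<close> be a minimum 2-factor with \<open>2t\<close> odd cycles that attains \<open>m_star\<close>, and \<open>M\<close> the complementary perfect
  matching. Choose a matching \<open>N\<close> inside \<open>F\<close> that covers all vertices except one vertex on each odd
  cycle. The union of two matchings is bipartite, so there are vertex signs alternating along the
  edges of \<open>M\<close> and of \<open>N\<close>; half of the \<open>2t\<close> exceptional vertices are positive and half negative.
  Orient \<open>M\<close> from positive to negative vertices and the cycles of \<open>F\<close> cyclically. By Hoffman's
  circulation theorem a flow with values in \<open>{1, \<dots>, 4}\<close> exists if \<open>q \<le> 4 p\<close> for every vertex set \<open>X\<close>
  with \<open>p\<close> leaving and \<open>q\<close> entering edges. If \<open>c\<close> edges of \<open>F\<close> leave \<open>X\<close>, then \<open>c\<close> enter it, so \<open>c \<le> p\<close>;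
  and \<open>q - p\<close>, the negated sum of the signs in \<open>X\<close>, is at most \<open>2c\<close> plus the number of negative
  exceptional vertices in \<open>X\<close>, because the edges of \<open>N\<close> inside \<open>X\<close> cancel. If the cycles of these
  vertices all leave \<open>X\<close>, that number is at most \<open>c\<close> and \<open>q \<le> p + 3c \<le> 4p\<close>; symmetrically for the
  positive exceptional vertices outside \<open>X\<close>. Otherwise the cut separates two odd cycles, so
  \<open>p + q \<ge> 5t - 1\<close>, and with \<open>q - p \<le> 2c + t\<close> this again gives \<open>q \<le> 4p\<close>.
\<close>

section \<open>Circulations with prescribed bounds\<close>

text \<open>The largest net outflow of \<open>X\<close> that the bounds permit edge by edge; the cut
  condition asks it to be at least the net outflow prescribed for \<open>X\<close>.\<close>

definition cut_capacity ::
    "'e set \<Rightarrow> ('e \<Rightarrow> 'v) \<Rightarrow> ('e \<Rightarrow> 'v) \<Rightarrow> ('e \<Rightarrow> int) \<Rightarrow> ('e \<Rightarrow> int) \<Rightarrow> 'v set \<Rightarrow> int" where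
  "cut_capacity E ta he l u X =
     (\<Sum>e\<in>E. if ta e \<in> X \<and> he e \<notin> X then u e
             else if he e \<in> X \<and> ta e \<notin> X then - l e else 0)"

text \<open>A single sum with signed incidences, so that summing over a vertex set is just an
  exchange of two sums.\<close>

definition net_outflow ::
    "'e set \<Rightarrow> ('e \<Rightarrow> 'v) \<Rightarrow> ('e \<Rightarrow> 'v) \<Rightarrow> ('e \<Rightarrow> int) \<Rightarrow> 'v \<Rightarrow> int" where
  "net_outflow E ta he f v = (\<Sum>e\<in>E. f e * (of_bool (ta e = v) - of_bool (he e = v)))"

lemma net_outflow_eq:
  assumes "finite E"
  shows "net_outflow E ta he f v = sum f {e \<in> E. ta e = v} - sum f {e \<in> E. he e = v}"
  using assms
  by (simp add: net_outflow_def sum.inter_filter right_diff_distrib sum_subtractf of_bool_def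
      if_distrib[of "(*) _"] cong: if_cong)

text \<open>Only edges between \<open>X - Y\<close> and \<open>Y - X\<close> count differently on
  the two sides: each adds \<open>u e - l e\<close> on the right and nothing on the left. The given
  edge is of this kind and has positive slack, which makes the inequality strict.\<close>

lemma cut_capacity_submodular:
  assumes "finite E" "\<And>e. e \<in> E \<Longrightarrow> l e \<le> u e" "e \<in> E"
    and "ta e \<in> X" "he e \<notin> X" "he e \<in> Y" "ta e \<notin> Y" "l e < u e"
  shows "cut_capacity E ta he l u (X \<inter> Y) + cut_capacity E ta he l u (X \<union> Y)
       < cut_capacity E ta he l u X + cut_capacity E ta he l u Y"
  unfolding cut_capacity_def sum.distrib[symmetric]
  by (rule sum_strict_mono_ex1[OF assms(1)], use assms(2) in force,
      rule bexI[OF _ assms(3)], use assms(4-) in simp)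

lemma cut_capacity_fixed:
  assumes "finite E" "\<And>e. e \<in> E \<Longrightarrow> l e = u e"
  shows "cut_capacity E ta he l u X = (\<Sum>e\<in>E. l e * (of_bool (ta e \<in> X) - of_bool (he e \<in> X)))"
  unfolding cut_capacity_def by (rule sum.cong) (auto simp: assms)

lemma cut_capacity_decr:
  assumes "finite E" "e \<in> E"
  shows "cut_capacity E ta he l (u(e := u e - 1)) X
       = cut_capacity E ta he l u X - of_bool (ta e \<in> X \<and> he e \<notin> X)"
proof -
  have "cut_capacity E ta he l (u(e := u e - 1)) X
      = (\<Sum>x\<in>E. (if ta x \<in> X \<and> he x \<notin> X then u x
                else if he x \<in> X \<and> ta x \<notin> X then - l x else 0)
              - (if x = e then of_bool (ta e \<in> X \<and> he e \<notin> X) else 0))"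
    unfolding cut_capacity_def by (rule sum.cong) auto
  then show ?thesis
    by (simp add: cut_capacity_def sum_subtractf assms)
qed

lemma cut_capacity_incr:
  assumes "finite E" "e \<in> E"
  shows "cut_capacity E ta he (l(e := l e + 1)) u X
       = cut_capacity E ta he l u X - of_bool (he e \<in> X \<and> ta e \<notin> X)"
proof -
  have "cut_capacity E ta he (l(e := l e + 1)) u X
      = (\<Sum>x\<in>E. (if ta x \<in> X \<and> he x \<notin> X then u x
                else if he x \<in> X \<and> ta x \<notin> X then - l x else 0)
              - (if x = e then of_bool (he e \<in> X \<and> ta e \<notin> X) else 0))"
    unfolding cut_capacity_def by (rule sum.cong) auto
  then show ?thesis
    by (simp add: cut_capacity_def sum_subtractf assms)
qed

text \<open>The bounds are tightened one unit at a time: an edge at which neither bound can be tightened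
  leaves one tight set and enters another, and uncrossing the two sets violates the cut
  condition.\<close>

theorem hoffman_circulation:
  fixes l u :: "'e \<Rightarrow> int" and b :: "'v \<Rightarrow> int"
  assumes "finite V" "finite E" "ta ` E \<subseteq> V" "he ` E \<subseteq> V"
    and "\<And>e. e \<in> E \<Longrightarrow> l e \<le> u e" "sum b V = 0"
    and "\<And>X. X \<subseteq> V \<Longrightarrow> sum b X \<le> cut_capacity E ta he l u X"
  shows "\<exists>f. (\<forall>e\<in>E. l e \<le> f e \<and> f e \<le> u e) \<and> (\<forall>v\<in>V. net_outflow E ta he f v = b v)"
  using assms(5,7)
proof (induction "nat (\<Sum>e\<in>E. u e - l e)" arbitrary: l u rule: less_induct)
  case less
  note bounds = less.prems(1) and cut = less.prems(2)
  show ?case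
  proof (cases "\<forall>e\<in>E. l e = u e")
    case True
    have fixed: "cut_capacity E ta he l u X
        = (\<Sum>e\<in>E. l e * (of_bool (ta e \<in> X) - of_bool (he e \<in> X)))" for X
      by (rule cut_capacity_fixed) (use True assms(2) in auto)
    \<comment> \<open>With equal bounds, the capacity of a set is its net outflow under
      \<open>l\<close>. The cut condition for \<open>{v}\<close> bounds the outflow at
      \<open>v\<close> from below; the one for the complement, combined with
      \<open>sum b V = 0\<close>, bounds it from above.\<close>
    have "net_outflow E ta he l v = b v" if v: "v \<in> V" for v
    proof (rule antisym)
      have ends: "of_bool (ta e \<in> V - {v}) = 1 - (of_bool (ta e = v) :: int)"
          "of_bool (he e \<in> V - {v}) = 1 - (of_bool (he e = v) :: int)" if "e \<in> E" for e
        using that assms(3,4) by auto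
      have "cut_capacity E ta he l u (V - {v}) = - net_outflow E ta he l v"
        unfolding fixed net_outflow_def sum_negf[symmetric]
        by (rule sum.cong[OF refl], simp only: ends) (simp add: algebra_simps)
      moreover have "sum b (V - {v}) = - b v"
        using assms(1,6) v by (simp add: sum_diff1)
      ultimately show "net_outflow E ta he l v \<le> b v"
        using cut[of "V - {v}"] by auto
      show "b v \<le> net_outflow E ta he l v"
        using cut[of "{v}"] v by (simp add: fixed net_outflow_def)
    qed
    with True show ?thesis by (intro exI[of _ l]) auto
  next
    case False
    then obtain e where e: "e \<in> E" "l e < u e"
      using bounds by (metis order_le_less)
    let ?l = "l(e := l e + 1)" and ?u = "u(e := u e - 1)"
    have smaller: "nat (\<Sum>x\<in>E. ?u x - l x) < nat (\<Sum>x\<in>E. u x - l x)"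
        "nat (\<Sum>x\<in>E. u x - ?l x) < nat (\<Sum>x\<in>E. u x - l x)"
    proof -
      have "(\<Sum>x\<in>E. ?u x - l x) = (\<Sum>x\<in>E. (u x - l x) - (if x = e then 1 else 0))"
          "(\<Sum>x\<in>E. u x - ?l x) = (\<Sum>x\<in>E. (u x - l x) - (if x = e then 1 else 0))"
        by (rule sum.cong[OF refl], simp)+
      moreover have "(\<Sum>x\<in>E. (u x - l x) - (if x = e then 1 else 0)) = (\<Sum>x\<in>E. u x - l x) - 1"
        using e by (subst sum_subtractf) (simp add: assms(2))
      moreover have "0 < (\<Sum>x\<in>E. u x - l x)"
        by (rule sum_pos2[OF assms(2) e(1)]) (use e bounds in auto)
      ultimately show "nat (\<Sum>x\<in>E. ?u x - l x) < nat (\<Sum>x\<in>E. u x - l x)"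
          "nat (\<Sum>x\<in>E. u x - ?l x) < nat (\<Sum>x\<in>E. u x - l x)"
        by linarith+
    qed
    show ?thesis
    proof (cases "\<forall>X\<subseteq>V. sum b X \<le> cut_capacity E ta he l ?u X")
      case True
      have "\<exists>f. (\<forall>x\<in>E. l x \<le> f x \<and> f x \<le> ?u x) \<and> (\<forall>v\<in>V. net_outflow E ta he f v = b v)"
        by (rule less.hyps[OF smaller(1)]) (use bounds e in simp, use True in blast)
      then obtain f where f: "\<forall>x\<in>E. l x \<le> f x \<and> f x \<le> ?u x" "\<forall>v\<in>V. net_outflow E ta he f v = b v"
        by blast
      moreover have "f x \<le> u x" if "x \<in> E" for x
        using bspec[OF f(1) that] by (simp split: if_splits)
      ultimately show ?thesis by blast
    next
      case no_decr: False
      then obtain X where "X \<subseteq> V" "cut_capacity E ta he l ?u X < sum b X"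
        by (meson linorder_not_le)
      \<comment> \<open>Lowering \<open>u e\<close> by one costs a set at most one unit of capacity,
        so by integrality a set that becomes violated was tight before and is left by
        \<open>e\<close>.\<close>
      then have X: "X \<subseteq> V" "ta e \<in> X" "he e \<notin> X" "cut_capacity E ta he l u X = sum b X"
        using cut[of X] unfolding cut_capacity_decr[OF assms(2) e(1)]
        by (cases "ta e \<in> X \<and> he e \<notin> X"; simp)+
      show ?thesis
      proof (cases "\<forall>Y\<subseteq>V. sum b Y \<le> cut_capacity E ta he ?l u Y")
        case True
        have "\<exists>f. (\<forall>x\<in>E. ?l x \<le> f x \<and> f x \<le> u x) \<and> (\<forall>v\<in>V. net_outflow E ta he f v = b v)"
          by (rule less.hyps[OF smaller(2)]) (use bounds e in simp, use True in blast)
        then obtain f where f: "\<forall>x\<in>E. ?l x \<le> f x \<and> f x \<le> u x" "\<forall>v\<in>V. net_outflow E ta he f v = b v"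
          by blast
        moreover have "l x \<le> f x" if "x \<in> E" for x
          using bspec[OF f(1) that] by (simp split: if_splits)
        ultimately show ?thesis by blast
      next
        case False
        then obtain Y where "Y \<subseteq> V" "cut_capacity E ta he ?l u Y < sum b Y"
          by (meson linorder_not_le)
        then have Y: "Y \<subseteq> V" "he e \<in> Y" "ta e \<notin> Y" "cut_capacity E ta he l u Y = sum b Y"
          using cut[of Y] unfolding cut_capacity_incr[OF assms(2) e(1)]
          by (cases "he e \<in> Y \<and> ta e \<notin> Y"; simp)+
        have "finite X" "finite Y" using X Y assms(1) finite_subset by auto
        then have "sum b (X \<union> Y) + sum b (X \<inter> Y) = sum b X + sum b Y"
          by (rule sum.union_inter)
        moreover have "sum b (X \<union> Y) \<le> cut_capacity E ta he l u (X \<union> Y)"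
            "sum b (X \<inter> Y) \<le> cut_capacity E ta he l u (X \<inter> Y)"
          using X Y by (auto intro!: cut)
        ultimately show ?thesis
          using cut_capacity_submodular[where l = l and u = u and ta = ta and he = he and X = X and Y = Y,
              OF assms(2) bounds e(1) X(2,3) Y(2,3) e(2)] X(4) Y(4)
          by linarith
      qed
    qed
  qed
qed

section \<open>Eulerian orientations\<close>

lemma net_outflow_sum:
  assumes "finite X"
  shows "sum (net_outflow E ta he f) X
    = (\<Sum>e\<in>E. f e * (of_bool (ta e \<in> X) - of_bool (he e \<in> X)))"
  unfolding net_outflow_def
  by (subst sum.swap) (auto simp: assms sum_distrib_left[symmetric] sum_subtractf of_bool_def intro!: sum.cong)

text \<open>Start from any orientation and reverse a suitable set of edges. Reversal subtracts twice
  the net outflow of the reversed set, so this set must be a 0-1 flow whose net outflow is half the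
  imbalance; even degrees make that half integral, and the circulation theorem supplies the
  flow.\<close>

lemma eulerian_orientation:
  fixes \<epsilon> :: "'e \<Rightarrow> 'v set"
  assumes "finite V" "finite E" "\<And>e. e \<in> E \<Longrightarrow> \<epsilon> e \<subseteq> V" "\<And>e. e \<in> E \<Longrightarrow> card (\<epsilon> e) = 2"
    and even: "\<And>v. v \<in> V \<Longrightarrow> even (card {e \<in> E. v \<in> \<epsilon> e})"
  obtains ta he where "\<And>e. e \<in> E \<Longrightarrow> \<epsilon> e = {ta e, he e}"
    and "\<And>v. v \<in> V \<Longrightarrow> card {e \<in> E. ta e = v} = card {e \<in> E. he e = v}"
proof -
  have "\<forall>e. \<exists>p. e \<in> E \<longrightarrow> \<epsilon> e = {fst p, snd p} \<and> fst p \<noteq> snd p"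
    using assms(4) by (metis card_2_iff fst_conv snd_conv)
  then obtain p where p: "\<And>e. e \<in> E \<Longrightarrow> \<epsilon> e = {fst (p e), snd (p e)} \<and> fst (p e) \<noteq> snd (p e)"
    by metis
  define t h where "t = fst \<circ> p" and "h = snd \<circ> p"
  have th: "\<epsilon> e = {t e, h e}" "t e \<noteq> h e" if "e \<in> E" for e
    using p[OF that] by (auto simp: t_def h_def)
  define b where "b v = net_outflow E t h (\<lambda>_. 1) v div 2" for v
  have b: "2 * b v = net_outflow E t h (\<lambda>_. 1) v" if "v \<in> V" for v
  proof -
    have "card {e \<in> E. v \<in> \<epsilon> e} = card ({e \<in> E. t e = v} \<union> {e \<in> E. h e = v})"
      by (rule arg_cong[of _ _ card]) (use th in auto)
    also have "\<dots> = card {e \<in> E. t e = v} + card {e \<in> E. h e = v}"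
      by (rule card_Un_disjoint) (use assms(2) in auto, metis th(2))
    finally have "even (card {e \<in> E. t e = v} + card {e \<in> E. h e = v})"
      using even[OF that] by simp
    then have "even (int (card {e \<in> E. t e = v}) - int (card {e \<in> E. h e = v}))"
      by simp
    then show ?thesis unfolding b_def net_outflow_eq[OF assms(2)] by simp
  qed
  have sumb: "2 * sum b X = (\<Sum>e\<in>E. of_bool (t e \<in> X) - of_bool (h e \<in> X))" if "X \<subseteq> V" for X
  proof -
    have "2 * sum b X = sum (net_outflow E t h (\<lambda>_. 1)) X"
      using b that by (auto simp: sum_distrib_left intro!: sum.cong)
    also have "\<dots> = (\<Sum>e\<in>E. of_bool (t e \<in> X) - of_bool (h e \<in> X))"
      by (subst net_outflow_sum[OF finite_subset[OF that assms(1)]]) simp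
    finally show ?thesis .
  qed
  have V: "t ` E \<subseteq> V" "h ` E \<subseteq> V" using th(1) assms(3) by auto
  have "\<exists>f. (\<forall>e\<in>E. 0 \<le> f e \<and> f e \<le> 1) \<and> (\<forall>v\<in>V. net_outflow E t h f v = b v)"
  proof (rule hoffman_circulation[OF assms(1,2) V])
    have "2 * sum b V = 0"
      using V by (subst sumb) (auto simp: image_subset_iff intro!: sum.neutral)
    then show "sum b V = 0" by simp
    show "sum b X \<le> cut_capacity E t h (\<lambda>_. 0) (\<lambda>_. 1) X" if "X \<subseteq> V" for X
    \<comment> \<open>Edge by edge: twice the prescribed outflow of \<open>X\<close> is the number
      of leaving minus entering edges, hence at most twice the number of leaving edges, and the
      capacity is exactly that number.\<close>
    proof -
      have "2 * sum b X \<le> (\<Sum>e\<in>E. 2 * (if t e \<in> X \<and> h e \<notin> X then 1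
                else if h e \<in> X \<and> t e \<notin> X then - 0 else 0))"
        unfolding sumb[OF that] by (rule sum_mono) auto
      also have "\<dots> = 2 * cut_capacity E t h (\<lambda>_. 0) (\<lambda>_. 1) X"
        unfolding cut_capacity_def sum_distrib_left ..
      finally show ?thesis by simp
    qed
  qed simp
  then obtain f where f: "\<And>e. e \<in> E \<Longrightarrow> 0 \<le> f e \<and> f e \<le> 1" "\<And>v. v \<in> V \<Longrightarrow> net_outflow E t h f v = b v"
    by auto
  define ta he where "ta e = (if f e = 0 then t e else h e)" and "he e = (if f e = 0 then h e else t e)" for e
  have "card {e \<in> E. ta e = v} = card {e \<in> E. he e = v}" if v: "v \<in> V" for v
  proof -
    have "net_outflow E ta he (\<lambda>_. 1) v = net_outflow E t h (\<lambda>_. 1) v - 2 * net_outflow E t h f v"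
      unfolding net_outflow_def sum_distrib_left sum_subtractf[symmetric]
    proof (rule sum.cong[OF refl])
      fix e assume "e \<in> E"
      then have "f e = 0 \<or> f e = 1" using f(1) by force
      then show "1 * (of_bool (ta e = v) - of_bool (he e = v)) =
         1 * (of_bool (t e = v) - of_bool (h e = v)) -
         2 * (f e * (of_bool (t e = v) - of_bool (h e = v)))"
        by (auto simp: ta_def he_def)
    qed
    then have "net_outflow E ta he (\<lambda>_. 1) v = 0"
      using b f(2) v by simp
    then show ?thesis by (simp add: net_outflow_eq[OF assms(2)])
  qed
  moreover have "\<epsilon> e = {ta e, he e}" if "e \<in> E" for e
    using th(1)[OF that] by (auto simp: ta_def he_def)
  ultimately show thesis using that by blast
qed

section \<open>Signs alternating along two matchings\<close>

text \<open>Contract an edge \<open>{x, y}\<close> of the second matching: deleting \<open>x\<close> and \<open>y\<close> and matching their partners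
  with each other preserves the parity of every alternating path or cycle.\<close>

lemma alternating_signs:
  assumes "finite V" "\<And>v. v \<in> V \<Longrightarrow> \<mu> v \<in> V \<and> \<mu> v \<noteq> v \<and> \<mu> (\<mu> v) = v"
    and "N \<subseteq> V \<times> V" "inj_on fst N" "inj_on snd N" "fst ` N \<inter> snd ` N = {}"
  shows "\<exists>s :: 'v \<Rightarrow> int. (\<forall>v\<in>V. s v \<in> {1, -1} \<and> s (\<mu> v) = - s v) \<and> (\<forall>(x, y)\<in>N. s y = - s x)"
  using assms
proof (induction "card V" arbitrary: V \<mu> N rule: less_induct)
  case less
  note V = less.prems(1) and \<mu> = less.prems(2) and N = less.prems(3-6)
  show ?case
  proof (cases "V = {}")
    case True
    with N show ?thesis by auto
  next
    case False
    have touch: "p = q" if "p \<in> N" "q \<in> N" "{fst p, snd p} \<inter> {fst q, snd q} \<noteq> {}" for p q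
      using that N(2-4) by (auto dest: inj_onD)
    \<comment> \<open>A pair of \<open>N\<close> that is not a \<open>\<mu>\<close>-edge gets
      contracted. If there is none, the two vertices of some pair, or any \<open>x\<close> with its
      partner when \<open>N\<close> is empty, can be removed without meeting the rest of
      \<open>N\<close>.\<close>
    consider x where "x \<in> V" "N \<subseteq> {(x, \<mu> x)} \<union> (V - {x, \<mu> x}) \<times> (V - {x, \<mu> x})"
      | x y where "(x, y) \<in> N" "y \<noteq> \<mu> x"
    proof (cases "\<exists>(x, y)\<in>N. y \<noteq> \<mu> x")
      case False
      show ?thesis
      proof (cases "N = {}")
        case True
        then show ?thesis using \<open>V \<noteq> {}\<close> that(1) by blast
      next
        case nonempty: False
        then obtain p where "p \<in> N" by blast
        with False have "(fst p, \<mu> (fst p)) \<in> N" by (cases p) auto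
        then obtain x where x: "(x, \<mu> x) \<in> N" by blast
        have "p \<in> {(x, \<mu> x)} \<union> (V - {x, \<mu> x}) \<times> (V - {x, \<mu> x})" if "p \<in> N" for p
          using touch[OF that x] that N(1) by (cases p) auto
        then show ?thesis using that(1)[of x] x N(1) by blast
      qed
    qed (use that(2) in blast)
    then show ?thesis
    proof cases
      case (2 x y)
      let ?V = "V - {x, y}" and ?N = "N - {(x, y)}"
      let ?\<mu> = "\<mu>(\<mu> x := \<mu> y, \<mu> y := \<mu> x)"
      have xy: "x \<in> V" "y \<in> V" "x \<noteq> y" using 2 N by force+
      note \<mu>xy = \<mu>[OF xy(1)] \<mu>[OF xy(2)]
      have "\<exists>s :: 'v \<Rightarrow> int. (\<forall>v\<in>?V. s v \<in> {1, -1} \<and> s (?\<mu> v) = - s v) \<and> (\<forall>(x, y)\<in>?N. s y = - s x)"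
      proof (rule less.hyps)
        show "card ?V < card V"
          using xy V by (intro psubset_card_mono) auto
        show "?\<mu> v \<in> ?V \<and> ?\<mu> v \<noteq> v \<and> ?\<mu> (?\<mu> v) = v" if v: "v \<in> ?V" for v
        proof (cases "v = \<mu> x \<or> v = \<mu> y")
          case True
          then show ?thesis using \<mu>xy 2 xy by (auto; metis)
        next
          case False
          then have "\<mu> v \<noteq> x" "\<mu> v \<noteq> y" "\<mu> v \<noteq> \<mu> x" "\<mu> v \<noteq> \<mu> y"
            using v \<mu>[of v] \<mu>xy by (auto; metis)+
          then show ?thesis using False \<mu>[of v] v by auto
        qed
        show "?N \<subseteq> ?V \<times> ?V"
        proof
          fix p assume p: "p \<in> ?N"
          then have "{fst p, snd p} \<inter> {x, y} = {}"
            using touch[of p "(x, y)"] 2 by auto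
          then show "p \<in> ?V \<times> ?V" using p N(1) by (auto simp: mem_Times_iff)
        qed
        show "inj_on fst ?N" "inj_on snd ?N" "fst ` ?N \<inter> snd ` ?N = {}"
          using N by (auto intro: inj_on_diff)
      qed (use V in auto)
      then obtain s :: "'v \<Rightarrow> int" where s: "\<And>v. v \<in> ?V \<Longrightarrow> s v \<in> {1, -1} \<and> s (?\<mu> v) = - s v"
          "\<And>a b. (a, b) \<in> ?N \<Longrightarrow> s b = - s a"
        by blast
      have \<mu>V: "\<mu> x \<in> ?V" "\<mu> y \<in> ?V" "\<mu> x \<noteq> \<mu> y" using \<mu>xy 2 xy by (auto; metis)+
      \<comment> \<open>The old partners force these values. The partners are matched with each
        other by \<open>?\<mu>\<close> and so have opposite signs; hence \<open>x\<close> and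
        \<open>y\<close> do too, as the pair \<open>(x, y)\<close> requires.\<close>
      define s' where "s' = s(x := - s (\<mu> x), y := - s (\<mu> y))"
      have "s (\<mu> y) = - s (\<mu> x)" using s(1)[OF \<mu>V(1)] \<mu>V(3) by auto
      have *: "s' v \<in> {1, -1} \<and> s' (\<mu> v) = - s' v" if v: "v \<in> V" for v
      proof (cases "v \<in> {x, y, \<mu> x, \<mu> y}")
        case True
        have "s' (\<mu> x) = s (\<mu> x)" "s' (\<mu> y) = s (\<mu> y)" "s' x = - s (\<mu> x)" "s' y = - s (\<mu> y)"
          using \<mu>V xy by (auto simp: s'_def)
        moreover have "s (\<mu> x) \<in> {1, -1}" "s (\<mu> y) \<in> {1, -1}"
          using s(1)[OF \<mu>V(1)] s(1)[OF \<mu>V(2)] by blast+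
        moreover have "\<mu> (\<mu> x) = x" "\<mu> (\<mu> y) = y" using \<mu>xy by blast+
        moreover have "v = x \<or> v = y \<or> v = \<mu> x \<or> v = \<mu> y" using True by blast
        ultimately show ?thesis by (elim disjE; hypsubst) (simp_all, blast+)
      next
        case False
        then have "\<mu> v \<noteq> x" "\<mu> v \<noteq> y" "\<mu> v \<noteq> \<mu> x" "\<mu> v \<noteq> \<mu> y"
          using v \<mu>[of v] \<mu>xy by (auto; metis)+
        then show ?thesis using s(1)[of v] False v by (auto simp: s'_def)
      qed
      have "s' b = - s' a" if ab: "(a, b) \<in> N" for a b
      proof (cases "(a, b) = (x, y)")
        case True
        then show ?thesis using \<open>s (\<mu> y) = - s (\<mu> x)\<close> xy by (simp add: s'_def)
      next
        case False
        then have "a \<notin> {x, y}" "b \<notin> {x, y}" using touch[OF ab 2(1)] by auto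
        then show ?thesis using s(2)[of a b] ab False by (simp add: s'_def)
      qed
      with * show ?thesis by blast
    next
      case (1 x)
      let ?V = "V - {x, \<mu> x}" and ?N = "N - {(x, \<mu> x)}"
      have "\<exists>s :: 'v \<Rightarrow> int. (\<forall>v\<in>?V. s v \<in> {1, -1} \<and> s (\<mu> v) = - s v) \<and> (\<forall>(x, y)\<in>?N. s y = - s x)"
      proof (rule less.hyps)
        show "card ?V < card V"
          using 1 V by (intro psubset_card_mono) auto
        show "\<mu> v \<in> ?V \<and> \<mu> v \<noteq> v \<and> \<mu> (\<mu> v) = v" if "v \<in> ?V" for v
          using that \<mu>[of v] \<mu>[OF 1(1)] by (auto; metis)
        show "inj_on fst ?N" "inj_on snd ?N" "fst ` ?N \<inter> snd ` ?N = {}"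
          using N by (auto intro: inj_on_diff)
      qed (use V 1 in auto)
      then obtain s :: "'v \<Rightarrow> int" where s: "\<And>v. v \<in> ?V \<Longrightarrow> s v \<in> {1, -1} \<and> s (\<mu> v) = - s v"
          "\<And>a b. (a, b) \<in> ?N \<Longrightarrow> s b = - s a"
        by blast
      \<comment> \<open>No other edge of either matching meets these two vertices, so only their
        opposition matters.\<close>
      define s' where "s' = s(x := 1, \<mu> x := -1)"
      have "s' v \<in> {1, -1} \<and> s' (\<mu> v) = - s' v" if v: "v \<in> V" for v
      proof (cases "v \<in> {x, \<mu> x}")
        case True
        then show ?thesis using \<mu>[OF 1(1)] by (auto simp: s'_def)
      next
        case False
        then have "\<mu> v \<noteq> x" "\<mu> v \<noteq> \<mu> x" using v \<mu>[of v] \<mu>[OF 1(1)] by (auto; metis)+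
        then show ?thesis using s(1)[of v] False v by (auto simp: s'_def)
      qed
      moreover have "s' b = - s' a" if ab: "(a, b) \<in> N" for a b
      proof (cases "(a, b) = (x, \<mu> x)")
        case True
        then show ?thesis using \<mu>[OF 1(1)] not_sym[of "\<mu> x" x] by (simp add: s'_def)
      next
        case False
        then have "a \<notin> {x, \<mu> x}" "b \<notin> {x, \<mu> x}" using 1(2) ab by auto
        then show ?thesis using s(2)[of a b] ab False by (simp add: s'_def)
      qed
      ultimately show ?thesis by blast
    qed
  qed
qed

section \<open>Permutations and their orbits\<close>

lemma bij_betw_funpow_orbit:
  assumes "permutation \<sigma>"
  shows "bij_betw (\<lambda>n. (\<sigma> ^^ n) x) {..<card (orbit \<sigma> x)} (orbit \<sigma> x)"
    and "(\<sigma> ^^ card (orbit \<sigma> x)) x = x"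
proof -
  have x: "x \<in> orbit \<sigma> x" by (rule permutation_self_in_orbit[OF assms])
  let ?n = "funpow_dist1 \<sigma> x x"
  have bij: "bij_betw (\<lambda>n. (\<sigma> ^^ n) x) {0..<?n} (orbit \<sigma> x)"
    unfolding bij_betw_def
    using orbit_conv_funpow_dist1[OF x] inj_on_funpow_dist1[OF x] by simp
  have "card (orbit \<sigma> x) = ?n"
    using bij_betw_same_card[OF bij] by simp
  with bij funpow_dist1_prop[OF x]
  show "bij_betw (\<lambda>n. (\<sigma> ^^ n) x) {..<card (orbit \<sigma> x)} (orbit \<sigma> x)"
    and "(\<sigma> ^^ card (orbit \<sigma> x)) x = x"
    by (simp_all add: atLeast0LessThan)
qed

lemma orbit_eq_iff:
  assumes "permutation \<sigma>"
  shows "y \<in> orbit \<sigma> x \<longleftrightarrow> orbit \<sigma> y = orbit \<sigma> x"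
  using cyclic_on_orbit'[OF assms, of x] permutation_self_in_orbit[OF assms, of y]
  by (auto simp: cyclic_on_alldef)

lemma near_perfect_matching_of_permutation:
  assumes \<sigma>: "\<sigma> permutes V" and "finite V"
  obtains T U where "T \<union> \<sigma> ` T \<union> U = V"
    and "T \<inter> \<sigma> ` T = {}" "T \<inter> U = {}" "\<sigma> ` T \<inter> U = {}"
    and "bij_betw (orbit \<sigma>) U {K \<in> orbit \<sigma> ` V. odd (card K)}"
proof -
  have perm: "permutation \<sigma>" using assms permutation_permutes by blast
  \<comment> \<open>The choice depends on the orbit alone, so all its points share one starting
    point; \<open>n x\<close> is the length of the orbit and \<open>k x\<close> the position of
    \<open>x\<close> counted from that start.\<close>
  define r where "r K = (SOME x. x \<in> K)" for K :: "'a set"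
  define n where "n x = card (orbit \<sigma> x)" for x
  define k where "k x = (THE i. i < n x \<and> (\<sigma> ^^ i) (r (orbit \<sigma> x)) = x)" for x
  have r: "r (orbit \<sigma> x) \<in> orbit \<sigma> x" for x
    unfolding r_def by (rule someI) (rule permutation_self_in_orbit[OF perm])
  have orb_r: "orbit \<sigma> (r (orbit \<sigma> x)) = orbit \<sigma> x" for x
    using r orbit_eq_iff[OF perm] by blast
  have bij: "bij_betw (\<lambda>i. (\<sigma> ^^ i) (r (orbit \<sigma> x))) {..<n x} (orbit \<sigma> x)" for x
    using bij_betw_funpow_orbit(1)[OF perm, of "r (orbit \<sigma> x)"] by (simp add: orb_r n_def)
  have wrap: "(\<sigma> ^^ n x) (r (orbit \<sigma> x)) = r (orbit \<sigma> x)" for x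
    using bij_betw_funpow_orbit(2)[OF perm, of "r (orbit \<sigma> x)"] by (simp add: orb_r n_def)
  have "\<exists>!i. i < n x \<and> (\<sigma> ^^ i) (r (orbit \<sigma> x)) = x" for x
    using bij[of x] permutation_self_in_orbit[OF perm, of x]
    unfolding bij_betw_def inj_on_def by force
  then have k: "k x < n x" "(\<sigma> ^^ k x) (r (orbit \<sigma> x)) = x" for x
    using theI'[of "\<lambda>i. i < n x \<and> (\<sigma> ^^ i) (r (orbit \<sigma> x)) = x"] by (auto simp: k_def)
  have k_eq: "k x = i" if "i < n x" "(\<sigma> ^^ i) (r (orbit \<sigma> x)) = x" for x i
    using bij[of x] k[of x] that unfolding bij_betw_def inj_on_def by force
  have step: "orbit \<sigma> (\<sigma> x) = orbit \<sigma> x" "n (\<sigma> x) = n x" for x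
    by (simp_all add: n_def permutation_orbit_step[OF perm])
  have k_step: "k (\<sigma> x) = Suc (k x)" if "Suc (k x) < n x" for x
    by (rule k_eq) (use that k[of x] step in simp_all)
  \<comment> \<open>Parity is counted from the end: the last point has \<open>n x - k x = 1\<close>
    and is not in \<open>T\<close>, so no pair wraps around past the representative.\<close>
  define T where "T = {x \<in> V. even (n x - k x)}"
  define U where "U = {x \<in> V. odd (n x) \<and> k x = 0}"
  have T_step: "Suc (k x) < n x" if "x \<in> T" for x
  proof -
    have "n x - k x \<noteq> 1" using that by (auto simp: T_def simp del: even_diff_nat)
    then show ?thesis using k(1)[of x] by simp
  qed
  have inV: "\<sigma> x \<in> V \<longleftrightarrow> x \<in> V" for x using permutes_in_image[OF \<sigma>] .
  have \<sigma>T: "\<sigma> ` T = {x \<in> V. odd (n x - k x) \<and> k x \<noteq> 0}"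
  proof (intro equalityI subsetI)
    fix y assume "y \<in> \<sigma> ` T"
    then obtain x where x: "x \<in> T" "y = \<sigma> x" by blast
    have "k y = Suc (k x)" "n x - k x = Suc (n y - k y)" "y \<in> V"
      using T_step[OF x(1)] k_step[of x] step inV[of x] x by (auto simp: T_def)
    moreover have "even (n x - k x)" using x by (simp add: T_def del: even_diff_nat)
    ultimately show "y \<in> {x \<in> V. odd (n x - k x) \<and> k x \<noteq> 0}"
      by (simp del: even_diff_nat)
  next
    fix y assume y: "y \<in> {x \<in> V. odd (n x - k x) \<and> k x \<noteq> 0}"
    then obtain i where i: "k y = Suc i" by (cases "k y") auto
    define x where "x = (\<sigma> ^^ i) (r (orbit \<sigma> y))"
    have "y = \<sigma> x" using k(2)[of y] by (simp add: i x_def)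
    then have orb: "orbit \<sigma> x = orbit \<sigma> y" "n x = n y" using step[of x] by simp_all
    then have "k x = i"
      by (intro k_eq) (use k(1)[of y] i x_def in auto)
    then have "x \<in> T" using y k(1)[of y] inV \<open>y = \<sigma> x\<close> orb i
      by (auto simp: T_def)
    then show "y \<in> \<sigma> ` T" using \<open>y = \<sigma> x\<close> by blast
  qed
  show thesis
  proof
    show "T \<union> \<sigma> ` T \<union> U = V"
      unfolding \<sigma>T by (auto simp: T_def U_def)
    show "T \<inter> \<sigma> ` T = {}" "T \<inter> U = {}" "\<sigma> ` T \<inter> U = {}"
      unfolding \<sigma>T by (auto simp: T_def U_def)
    have k0: "k x = 0 \<longleftrightarrow> x = r (orbit \<sigma> x)" for x
      using k(2)[of x] k_eq[of 0 x] k(1)[of x] by auto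
    show "bij_betw (orbit \<sigma>) U {K \<in> orbit \<sigma> ` V. odd (card K)}"
      unfolding bij_betw_def
    proof (intro conjI equalityI subsetI inj_onI)
      fix x y assume "x \<in> U" "y \<in> U" "orbit \<sigma> x = orbit \<sigma> y"
      then show "x = y" using k0 by (metis (mono_tags, lifting) U_def mem_Collect_eq)
    next
      fix K assume "K \<in> {K \<in> orbit \<sigma> ` V. odd (card K)}"
      then obtain x where x: "x \<in> V" "K = orbit \<sigma> x" "odd (n x)" by (auto simp: n_def)
      have "r K \<in> V" using r[of x] x permutes_orbit_subset[OF \<sigma>] by blast
      then have "r K \<in> U" using x k0[of "r K"] by (auto simp: U_def orb_r n_def)
      then show "K \<in> orbit \<sigma> ` U" using x orb_r[of x] by (metis image_eqI)
    qed (auto simp: U_def n_def)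
  qed
qed

section \<open>Boundary crossings of a permutation and alternating sums\<close>

text \<open>\<open>\<sigma>\<close> maps the points with image in \<open>W\<close> bijectively onto
  \<open>W\<close>. The two sets thus have equal size, and removing the points of \<open>W\<close>
  with image in \<open>W\<close> from both leaves the entries and the exits.\<close>

lemma card_exits_eq_card_entries:
  assumes "\<sigma> permutes V" "finite V" "W \<subseteq> V"
  shows "card {v \<in> V. v \<notin> W \<and> \<sigma> v \<in> W} = card {v \<in> V. v \<in> W \<and> \<sigma> v \<notin> W}"
proof -
  have "bij_betw \<sigma> {v \<in> V. \<sigma> v \<in> W} W"
    unfolding bij_betw_def
  proof
    show "inj_on \<sigma> {v \<in> V. \<sigma> v \<in> W}"
      using permutes_inj[OF assms(1)] by (meson inj_on_subset subset_UNIV)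
    show "\<sigma> ` {v \<in> V. \<sigma> v \<in> W} = W"
      using permutes_image[OF assms(1)] assms(3) by (auto simp: image_iff)
  qed
  then have "card {v \<in> V. \<sigma> v \<in> W} = card W" by (rule bij_betw_same_card)
  moreover have "card {v \<in> V. \<sigma> v \<in> W}
      = card ({v \<in> V. v \<notin> W \<and> \<sigma> v \<in> W} \<union> {v \<in> V. v \<in> W \<and> \<sigma> v \<in> W})"
    by (rule arg_cong[of _ _ card]) auto
  moreover have "card W = card ({v \<in> V. v \<in> W \<and> \<sigma> v \<notin> W} \<union> {v \<in> V. v \<in> W \<and> \<sigma> v \<in> W})"
    by (rule arg_cong[of _ _ card]) (use assms(3) in auto)
  moreover have "card ({v \<in> V. v \<notin> W \<and> \<sigma> v \<in> W} \<union> {v \<in> V. v \<in> W \<and> \<sigma> v \<in> W})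
      = card {v \<in> V. v \<notin> W \<and> \<sigma> v \<in> W} + card {v \<in> V. v \<in> W \<and> \<sigma> v \<in> W}"
    by (rule card_Un_disjoint) (use assms(2) in auto)
  moreover have "card ({v \<in> V. v \<in> W \<and> \<sigma> v \<notin> W} \<union> {v \<in> V. v \<in> W \<and> \<sigma> v \<in> W})
      = card {v \<in> V. v \<in> W \<and> \<sigma> v \<notin> W} + card {v \<in> V. v \<in> W \<and> \<sigma> v \<in> W}"
    by (rule card_Un_disjoint) (use assms(2) in auto)
  ultimately show ?thesis by linarith
qed

text \<open>An orbit that meets \<open>W\<close> but is not contained in it must leave
  \<open>W\<close> at some point. The elements of \<open>A\<close> lie on different orbits, so these
  exit points are distinct.\<close>

lemma card_split_orbits_le_exits:
  assumes "\<sigma> permutes V" "finite V" "A \<subseteq> W" "W \<subseteq> V" "inj_on (orbit \<sigma>) A"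
    and "\<And>u. u \<in> A \<Longrightarrow> \<not> orbit \<sigma> u \<subseteq> W"
  shows "card A \<le> card {v \<in> V. v \<in> W \<and> \<sigma> v \<notin> W}"
proof -
  have perm: "permutation \<sigma>" using assms(1,2) permutation_permutes by blast
  have "\<exists>v\<in>orbit \<sigma> u. v \<in> W \<and> \<sigma> v \<notin> W" if "u \<in> A" for u
  proof (rule ccontr)
    assume no_exit: "\<not> ?thesis"
    have "v \<in> W" if "v \<in> orbit \<sigma> u" for v
      using that
    proof induction
      case base
      then show ?case
        using no_exit permutation_self_in_orbit[OF perm, of u] \<open>u \<in> A\<close> assms(3) by blast
    qed (use no_exit in blast)
    with assms(6) \<open>u \<in> A\<close> show False by blast
  qed
  then obtain g where g: "\<And>u. u \<in> A \<Longrightarrow> g u \<in> orbit \<sigma> u \<and> g u \<in> W \<and> \<sigma> (g u) \<notin> W"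
    by metis
  have "inj_on g A"
  proof (rule inj_onI)
    fix x y assume "x \<in> A" "y \<in> A" "g x = g y"
    then show "x = y" using g[of x] g[of y] orbit_eq_iff[OF perm] assms(5)
      by (metis inj_onD)
  qed
  then show ?thesis
    by (rule card_inj_on_le) (use g assms(2,4) in auto)
qed

text \<open>The pairs formed by \<open>v \<in> T\<close> and \<open>\<sigma> v\<close>, together
  with the points of \<open>U\<close>, partition \<open>V\<close>. A pair inside \<open>W\<close>
  cancels, so only the pairs cut by \<open>W\<close> and the unpaired points contribute.\<close>

lemma alternating_sum_eq:
  fixes r :: "'v \<Rightarrow> int"
  assumes \<sigma>: "\<sigma> permutes V" and "finite V" and TU: "T \<union> \<sigma> ` T \<union> U = V"
    "T \<inter> \<sigma> ` T = {}" "T \<inter> U = {}" "\<sigma> ` T \<inter> U = {}"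
    and "\<And>v. v \<in> T \<Longrightarrow> r (\<sigma> v) = - r v" "W \<subseteq> V"
  shows "sum r W = (\<Sum>v\<in>T. r v * (of_bool (v \<in> W) - of_bool (\<sigma> v \<in> W))) + sum r (U \<inter> W)"
proof -
  have fin: "finite T" "finite U" using assms(2) TU(1) finite_subset by blast+
  have "sum r W = (\<Sum>v\<in>T \<union> \<sigma> ` T \<union> U. r v * of_bool (v \<in> W))"
    unfolding TU(1) using assms(2,8)
    by (simp add: of_bool_def if_distrib[of "(*) _"] sum.inter_restrict[symmetric] Int_absorb1 cong: if_cong)
  also have "\<dots> = (\<Sum>v\<in>T. r v * of_bool (v \<in> W)) + (\<Sum>v\<in>\<sigma> ` T. r v * of_bool (v \<in> W))
      + (\<Sum>v\<in>U. r v * of_bool (v \<in> W))"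
    using TU fin by (subst sum.union_disjoint; (subst sum.union_disjoint)?) auto
  also have "(\<Sum>v\<in>\<sigma> ` T. r v * of_bool (v \<in> W)) = (\<Sum>v\<in>T. - r v * of_bool (\<sigma> v \<in> W))"
    by (subst sum.reindex) (use permutes_inj[OF \<sigma>] assms(7) in \<open>auto intro: inj_on_subset\<close>)
  also have "(\<Sum>v\<in>U. r v * of_bool (v \<in> W)) = sum r (U \<inter> W)"
    using fin by (simp add: of_bool_def if_distrib[of "(*) _"] sum.inter_restrict cong: if_cong)
  finally show ?thesis
    by (simp add: right_diff_distrib sum_subtractf sum_negf)
qed

text \<open>A pair cut by \<open>W\<close> contributes at most 1 and is an exit or an entry of
  \<open>\<sigma>\<close>; exits and entries are equally many, hence the factor 2. Unpaired points
  contribute at most the number of those with value 1.\<close>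

lemma alternating_sum_le:
  fixes r :: "'v \<Rightarrow> int"
  assumes \<sigma>: "\<sigma> permutes V" and "finite V" and TU: "T \<union> \<sigma> ` T \<union> U = V"
    "T \<inter> \<sigma> ` T = {}" "T \<inter> U = {}" "\<sigma> ` T \<inter> U = {}"
    and "\<And>v. v \<in> T \<Longrightarrow> r (\<sigma> v) = - r v" "W \<subseteq> V"
    and r: "\<And>v. v \<in> V \<Longrightarrow> r v \<in> {1, -1}"
  shows "sum r W \<le> 2 * int (card {v \<in> V. v \<in> W \<and> \<sigma> v \<notin> W}) + int (card {u \<in> U \<inter> W. r u = 1})"
proof -
  let ?out = "{v \<in> V. v \<in> W \<and> \<sigma> v \<notin> W}" and ?in = "{v \<in> V. v \<notin> W \<and> \<sigma> v \<in> W}"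
  have fin: "finite T" "finite U" using assms(2) TU(1) finite_subset by blast+
  have "(\<Sum>v\<in>T. r v * (of_bool (v \<in> W) - of_bool (\<sigma> v \<in> W)))
      \<le> (\<Sum>v\<in>T. of_bool (v \<in> ?out) + of_bool (v \<in> ?in))"
  proof (rule sum_mono)
    fix v assume "v \<in> T"
    then have "v \<in> V" "r v \<in> {1, -1}" using TU(1) r by auto
    then show "r v * (of_bool (v \<in> W) - of_bool (\<sigma> v \<in> W)) \<le> of_bool (v \<in> ?out) + of_bool (v \<in> ?in)"
      by auto
  qed
  also have "\<dots> \<le> (\<Sum>v\<in>V. of_bool (v \<in> ?out) + of_bool (v \<in> ?in))"
    using TU(1) assms(2) by (intro sum_mono2) auto
  also have "\<dots> = int (card ?out) + int (card ?in)"
    using assms(2) by (simp add: sum.distrib Int_def)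
  also have "\<dots> = 2 * int (card ?out)"
    by (simp add: card_exits_eq_card_entries[OF \<sigma> assms(2,8)])
  finally have "(\<Sum>v\<in>T. r v * (of_bool (v \<in> W) - of_bool (\<sigma> v \<in> W))) \<le> 2 * int (card ?out)" .
  moreover have "sum r (U \<inter> W) \<le> (\<Sum>u\<in>U \<inter> W. of_bool (r u = 1))"
    by (rule sum_mono) (use r TU(1) in force)
  moreover have "(\<Sum>u\<in>U \<inter> W. of_bool (r u = 1)) = int (card {u \<in> U \<inter> W. r u = 1})"
    using fin by (simp add: Int_def conj_assoc)
  ultimately show ?thesis
    using alternating_sum_eq[of \<sigma> V T U r W, OF assms(1-8)] by linarith
qed

section \<open>Cyclically oriented 2-factors\<close>

text \<open>Bijectivity of both maps encodes that every vertex has exactly one outgoing and one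
  incoming edge of \<open>F\<close>, so that the cycles are directed, including those made of two
  parallel edges.\<close>

locale oriented_two_factor =
  fixes G F :: "('v, 'e) mgraph" and ta he :: "'e \<Rightarrow> 'v"
  assumes multigraph: "multigraph G"
    and two_factor: "two_factor G F"
    and ends: "\<And>e. e \<in> edges F \<Longrightarrow> ends G e = {ta e, he e}"
    and bij_tail: "bij_betw ta (edges F) (vertices G)"
    and bij_head: "bij_betw he (edges F) (vertices G)"
begin

text \<open>The next vertex on the directed cycle. Fixing everything outside the graph makes it a
  permutation in the sense of \<open>permutes\<close>; its orbits in the graph are the vertex sets
  of the cycles.\<close>

definition succ :: "'v \<Rightarrow> 'v" where
  "succ v = (if v \<in> vertices G then he (inv_into (edges F) ta v) else v)"

lemma F_simps: "vertices F = vertices G" "ends F = ends G" "edges F \<subseteq> edges G"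
  using two_factor by (auto simp: two_factor_def subgraph_def)

lemma finite_vertices: "finite (vertices G)"
  using multigraph by (rule multigraph.finite_vertices)

lemma succ_tail: "e \<in> edges F \<Longrightarrow> succ (ta e) = he e"
  using bij_tail by (auto simp: succ_def bij_betw_def)

lemma succ_permutes: "succ permutes vertices G"
proof (rule bij_imp_permutes)
  have "bij_betw (he \<circ> inv_into (edges F) ta) (vertices G) (vertices G)"
    using bij_betw_trans[OF bij_betw_inv_into[OF bij_tail] bij_head] .
  then show "bij_betw succ (vertices G) (vertices G)"
    by (rule bij_betw_cong[THEN iffD1, rotated]) (simp add: succ_def)
qed (simp add: succ_def)

lemma permutation_succ: "permutation succ"
  using succ_permutes finite_vertices permutation_permutes by blast

lemma edge_from:
  assumes "v \<in> vertices G"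
  obtains e where "e \<in> edges F" "ta e = v" "he e = succ v"
proof -
  have "v \<in> ta ` edges F" using assms bij_tail by (simp add: bij_betw_def)
  then obtain e where "e \<in> edges F" "ta e = v" by blast
  with succ_tail[of e] show thesis by (intro that) simp_all
qed

lemma orbit_subset_vertices: "u \<in> vertices G \<Longrightarrow> orbit succ u \<subseteq> vertices G"
  by (rule permutes_orbit_subset[OF succ_permutes])

text \<open>Stated for any \<open>H\<close> that keeps the edges of one cycle, because it serves
  both for \<open>F\<close> itself and for \<open>G\<close> after the removal of a cut.\<close>

lemma orbit_subset_reachable:
  assumes u: "u \<in> vertices G"
    and H: "\<And>e. e \<in> edges F \<Longrightarrow> ta e \<in> orbit succ u \<Longrightarrow> e \<in> edges H" "ends H = ends G"
  shows "orbit succ u \<subseteq> {v. (u, v) \<in> (adjacency H)\<^sup>*}"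
proof
  fix v assume "v \<in> orbit succ u"
  moreover have adj: "(x, succ x) \<in> adjacency H" if x: "x \<in> orbit succ u" for x
  proof -
    obtain e where "e \<in> edges F" "ta e = x" "he e = succ x"
      using edge_from[of x] orbit_subset_vertices[OF u] x by blast
    then show ?thesis using H ends[of e] x by (auto simp: adjacency_def)
  qed
  ultimately have "(u, v) \<in> (adjacency H)\<^sup>*"
  proof induction
    case base
    show ?case using adj[of u] permutation_self_in_orbit[OF permutation_succ] by blast
  next
    case (step y)
    then show ?case using adj[of y] by (meson rtrancl.rtrancl_into_rtrancl)
  qed
  then show "v \<in> {v. (u, v) \<in> (adjacency H)\<^sup>*}" by simp
qed

lemma reachable_eq_orbit:
  assumes u: "u \<in> vertices G"
  shows "{v. (u, v) \<in> (adjacency F)\<^sup>*} = orbit succ u"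
proof
  show "orbit succ u \<subseteq> {v. (u, v) \<in> (adjacency F)\<^sup>*}"
    by (rule orbit_subset_reachable[OF u]) (auto simp: F_simps)
  show "{v. (u, v) \<in> (adjacency F)\<^sup>*} \<subseteq> orbit succ u"
  proof clarify
    fix v assume "(u, v) \<in> (adjacency F)\<^sup>*"
    then show "v \<in> orbit succ u"
    proof induction
      case base
      show ?case by (rule permutation_self_in_orbit[OF permutation_succ])
    next
      case (step y z)
      then obtain e where "e \<in> edges F" "{ta e, he e} = {y, z}"
        by (auto simp: adjacency_def F_simps ends)
      then have "z = succ y \<or> y = succ z"
        using succ_tail[of e] by (auto simp: doubleton_eq_iff)
      \<comment> \<open>An undirected step may run against the orientation, but \<open>z\<close> and
        \<open>succ z\<close> have the same orbit.\<close>
      moreover have "z \<in> orbit succ u" if "y = succ z"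
        using step(3) that permutation_orbit_step[OF permutation_succ, of z] orbit_eq_iff[OF permutation_succ]
        by metis
      ultimately show ?case using step(3) orbit.step by metis
    qed
  qed
qed

text \<open>Every edge of a directed cycle is determined by its tail. This turns parity of the
  number of edges, which defines odd cycles, into parity of orbits.\<close>

lemma card_edges_orbit:
  assumes "u \<in> vertices G"
  shows "card (edges (induced F (orbit succ u))) = card (orbit succ u)"
proof -
  let ?K = "orbit succ u"
  have "he e \<in> ?K" if "e \<in> edges F" "ta e \<in> ?K" for e
    using that succ_tail[of e] orbit.step by metis
  then have "edges (induced F ?K) = {e \<in> edges F. ta e \<in> ?K}"
    using ends by (auto simp: induced_def F_simps)
  moreover have "bij_betw ta {e \<in> edges F. ta e \<in> ?K} ?K"
    using bij_tail orbit_subset_vertices[OF assms] unfolding bij_betw_def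
    by (auto simp: inj_on_def image_iff)
  ultimately show ?thesis by (simp add: bij_betw_same_card)
qed

lemma odd_cycles_eq:
  "odd_cycles F = induced F ` {K \<in> orbit succ ` vertices G. odd (card K)}"
proof -
  have "components F = induced F ` orbit succ ` vertices G"
    unfolding components_def F_simps image_image
    by (rule image_cong) (simp_all add: reachable_eq_orbit)
  then show ?thesis
    by (auto simp: odd_cycles_def card_edges_orbit)
qed

lemma card_odd_cycles:
  "card (odd_cycles F) = card {K \<in> orbit succ ` vertices G. odd (card K)}"
proof -
  have "inj (induced F)"
    by (rule injI) (drule arg_cong[of _ _ vertices], simp add: induced_def)
  then show ?thesis
    unfolding odd_cycles_eq by (rule card_image[OF inj_on_subset]) simp
qed

text \<open>A cycle lying on one side of \<open>X\<close> loses no edge and stays connected, hence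
  lies in one component of the remaining graph; no remaining edge joins the two sides, so the
  components of \<open>u\<close> and \<open>w\<close> differ.\<close>

lemma cut_separates_odd_cycles:
  fixes X :: "'v set"
  defines "C \<equiv> {e \<in> edges G. ends G e \<inter> X \<noteq> {} \<and> ends G e - X \<noteq> {}}"
  assumes u: "u \<in> vertices G" "odd (card (orbit succ u))" "orbit succ u \<subseteq> X"
    and w: "w \<in> vertices G" "odd (card (orbit succ w))" "orbit succ w \<inter> X = {}"
  shows "separates_odd_cycles G F C"
proof -
  let ?H = "delete_edges G C"
  let ?K = "\<lambda>u. induced ?H {v. (u, v) \<in> (adjacency ?H)\<^sup>*}"
  have H: "vertices ?H = vertices G" "edges ?H = edges G - C" "ends ?H = ends G"
    by (simp_all add: delete_edges_def)
  have kept: "e \<in> edges ?H" if e: "e \<in> edges F" "ta e \<in> orbit succ x"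
    and x: "orbit succ x \<subseteq> X \<or> orbit succ x \<inter> X = {}" for e x
  proof -
    have "he e \<in> orbit succ x" using e succ_tail[of e] orbit.step by metis
    then have "e \<notin> C" using e x ends[of e] by (auto simp: C_def)
    then show ?thesis using e F_simps(3) by (auto simp: H)
  qed
  have sub: "subgraph (induced F (orbit succ x)) (?K x)"
    if x: "x \<in> vertices G" "orbit succ x \<subseteq> X \<or> orbit succ x \<inter> X = {}" for x
  proof -
    have reach: "orbit succ x \<subseteq> {v. (x, v) \<in> (adjacency ?H)\<^sup>*}"
      by (rule orbit_subset_reachable[OF x(1)]) (use kept x H in auto)
    have "e \<in> edges ?H" if "e \<in> edges F" "ends G e \<subseteq> orbit succ x" for e
      using kept[OF that(1) _ x(2)] that ends by auto
    with reach show ?thesis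
      by (auto simp: subgraph_def induced_def H F_simps)
  qed
  have same_side: "(b \<in> X) = (a \<in> X)" if "(a, b) \<in> (adjacency ?H)\<^sup>*" for a b
    using that
  proof induction
    case (step y z)
    then obtain e where "e \<in> edges G" "e \<notin> C" "ends G e = {y, z}"
      by (auto simp: adjacency_def H)
    with step(3) show ?case by (auto simp: C_def)
  qed simp
  have self: "x \<in> orbit succ x" for x
    by (rule permutation_self_in_orbit[OF permutation_succ])
  have "u \<in> vertices (?K u)" "u \<notin> vertices (?K w)"
    using same_side[of w u] self u(3) w(3) by (auto simp: induced_def)
  then have "?K u \<noteq> ?K w" by metis
  moreover have "?K u \<in> components ?H" "?K w \<in> components ?H"
    using u(1) w(1) H by (auto simp: components_def)
  moreover have "induced F (orbit succ u) \<in> odd_cycles F" "induced F (orbit succ w) \<in> odd_cycles F"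
    using u w by (auto simp: odd_cycles_eq)
  ultimately show ?thesis
    unfolding separates_odd_cycles_def using sub u w by metis
qed

end

text \<open>In an Eulerian orientation of a 2-regular graph, in-degree and out-degree are equal and
  add up to 2, so both are 1.\<close>

lemma exists_oriented_two_factor:
  assumes "multigraph G" "two_factor G F"
  obtains ta he where "oriented_two_factor G F ta he"
proof -
  have F: "vertices F = vertices G" "ends F = ends G" "edges F \<subseteq> edges G" "regular 2 F"
    using assms(2) by (auto simp: two_factor_def subgraph_def)
  interpret multigraph G by (rule assms(1))
  have fin: "finite (edges F)" using F(3) finite_edges finite_subset by blast
  have deg: "card {e \<in> edges F. v \<in> ends G e} = 2" if "v \<in> vertices G" for v
    using F that by (simp add: regular_def degree_def)
  have "ends G e \<subseteq> vertices G" "card (ends G e) = 2" if "e \<in> edges F" for e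
    using that F(3) ends_subset card_ends by blast+
  then obtain ta he where ends: "\<And>e. e \<in> edges F \<Longrightarrow> ends G e = {ta e, he e}"
    and bal: "\<And>v. v \<in> vertices G \<Longrightarrow> card {e \<in> edges F. ta e = v} = card {e \<in> edges F. he e = v}"
    by (rule eulerian_orientation[OF finite_vertices fin, of "ends G"])
      (use deg in auto)
  have no_loop: "ta e \<noteq> he e" if "e \<in> edges F" for e
    using card_ends[of e] ends[OF that] F(3) that by auto
  have one: "card {e \<in> edges F. ta e = v} = 1" "card {e \<in> edges F. he e = v} = 1"
    if v: "v \<in> vertices G" for v
  proof -
    have "{e \<in> edges F. v \<in> ends G e} = {e \<in> edges F. ta e = v} \<union> {e \<in> edges F. he e = v}"
      using ends by auto
    moreover have "card ({e \<in> edges F. ta e = v} \<union> {e \<in> edges F. he e = v})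
        = card {e \<in> edges F. ta e = v} + card {e \<in> edges F. he e = v}"
      by (rule card_Un_disjoint) (use fin in auto, metis no_loop)
    ultimately show "card {e \<in> edges F. ta e = v} = 1" "card {e \<in> edges F. he e = v} = 1"
      using deg[OF v] bal[OF v] by auto
  qed
  have bij: "bij_betw g (edges F) (vertices G)"
    if g: "\<And>v. v \<in> vertices G \<Longrightarrow> card {e \<in> edges F. g e = v} = 1" "g ` edges F \<subseteq> vertices G"
    for g :: "'b \<Rightarrow> 'a"
    unfolding bij_betw_def
  proof
    show "inj_on g (edges F)"
    proof (rule inj_onI)
      fix x y assume xy: "x \<in> edges F" "y \<in> edges F" "g x = g y"
      then have "card {e \<in> edges F. g e = g y} = 1" using g by blast
      then obtain z where z: "{e \<in> edges F. g e = g y} = {z}"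
        by (auto simp: card_1_singleton_iff)
      have "x \<in> {z}" "y \<in> {z}" unfolding z[symmetric] using xy by simp_all
      then show "x = y" by simp
    qed
    show "g ` edges F = vertices G"
    proof
      show "vertices G \<subseteq> g ` edges F"
      proof
        fix v assume "v \<in> vertices G"
        then obtain z where z: "{e \<in> edges F. g e = v} = {z}"
          using g(1)[of v] by (auto simp: card_1_singleton_iff)
        have "z \<in> {e \<in> edges F. g e = v}" unfolding z by simp
        then show "v \<in> g ` edges F" by auto
      qed
    qed (rule g(2))
  qed
  have "ta ` edges F \<subseteq> vertices G" "he ` edges F \<subseteq> vertices G"
    using ends ends_subset F(3) by fastforce+
  then have "oriented_two_factor G F ta he"
    using assms ends bij one by unfold_locales auto
  then show thesis by (rule that)
qed

section \<open>The complementary perfect matching and the cut criterion for flows\<close>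

text \<open>Each vertex has degree 3 - 2 = 1 outside the 2-factor, so the remaining edges form a
  perfect matching; \<open>\<mu>\<close> sends a vertex to the other end of its matching
  edge.\<close>

lemma cubic_two_factor_partner:
  assumes "multigraph G" "cubic G" "two_factor G F"
  obtains \<mu> where "\<And>v. v \<in> vertices G \<Longrightarrow> \<mu> v \<in> vertices G \<and> \<mu> v \<noteq> v \<and> \<mu> (\<mu> v) = v"
    and "\<And>e v. e \<in> edges G - edges F \<Longrightarrow> v \<in> ends G e \<Longrightarrow> ends G e = {v, \<mu> v}"
    and "\<And>v. v \<in> vertices G \<Longrightarrow> card {e \<in> edges G - edges F. v \<in> ends G e} = 1"
proof -
  have F: "vertices F = vertices G" "ends F = ends G" "edges F \<subseteq> edges G" "regular 2 F"
    using assms(3) by (auto simp: two_factor_def subgraph_def)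
  interpret multigraph G by (rule assms(1))
  let ?M = "edges G - edges F"
  have one: "card {e \<in> ?M. v \<in> ends G e} = 1" if v: "v \<in> vertices G" for v
  proof -
    have "{e \<in> ?M. v \<in> ends G e} = {e \<in> edges G. v \<in> ends G e} - {e \<in> edges F. v \<in> ends G e}"
      by auto
    moreover have "card \<dots> = card {e \<in> edges G. v \<in> ends G e} - card {e \<in> edges F. v \<in> ends G e}"
      using F(3) finite_edges by (intro card_Diff_subset) (auto intro: finite_subset)
    ultimately show ?thesis
      using F v assms(2) by (simp add: regular_def degree_def)
  qed
  have "\<exists>e. {e \<in> ?M. v \<in> ends G e} = {e}" if "v \<in> vertices G" for v
    using one[OF that] by (simp add: card_1_singleton_iff)
  then obtain m where m: "\<And>v. v \<in> vertices G \<Longrightarrow> {e \<in> ?M. v \<in> ends G e} = {m v}"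
    by metis
  have mM: "m v \<in> ?M" "v \<in> ends G (m v)" if "v \<in> vertices G" for v
    using m[OF that] by blast+
  have m_eq: "e = m v" if "e \<in> ?M" "v \<in> ends G e" for e v
    using m[of v] ends_subset[of e] that by blast
  have "\<exists>w. ends G (m v) = {v, w} \<and> w \<noteq> v" if "v \<in> vertices G" for v
    using mM[OF that] card_ends[of "m v"] by (auto simp: card_2_iff doubleton_eq_iff)
  then obtain \<mu> where \<mu>: "\<And>v. v \<in> vertices G \<Longrightarrow> ends G (m v) = {v, \<mu> v} \<and> \<mu> v \<noteq> v"
    by metis
  show thesis
  proof
    fix v assume v: "v \<in> vertices G"
    have in_V: "\<mu> v \<in> vertices G" using ends_subset[of "m v"] mM[OF v] \<mu>[OF v] by auto
    have "m v = m (\<mu> v)" by (rule m_eq) (use mM[OF v] \<mu>[OF v] in auto)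
    then have "{v, \<mu> v} = {\<mu> v, \<mu> (\<mu> v)}" using \<mu>[OF v] \<mu>[OF in_V] by simp
    then show "\<mu> v \<in> vertices G \<and> \<mu> v \<noteq> v \<and> \<mu> (\<mu> v) = v"
      using in_V \<mu>[OF v] by (auto simp: doubleton_eq_iff)
  next
    fix e v assume e: "e \<in> ?M" "v \<in> ends G e"
    then have "v \<in> vertices G" using ends_subset by blast
    then show "ends G e = {v, \<mu> v}" using \<mu> m_eq[OF e] by blast
  qed (rule one)
qed

text \<open>This is the circulation theorem with lower bound 1, upper bound \<open>k\<close> and
  zero net outflow everywhere: the capacity of \<open>X\<close> is then \<open>k\<close> times the
  number of leaving edges minus the number of entering ones.\<close>

lemma has_nowhere_zero_flowI:
  assumes "multigraph G" and ends: "\<And>e. e \<in> edges G \<Longrightarrow> ends G e = {ta e, he e}"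
    and cut: "\<And>X. X \<subseteq> vertices G \<Longrightarrow>
      card {e \<in> edges G. he e \<in> X \<and> ta e \<notin> X} \<le> k * card {e \<in> edges G. ta e \<in> X \<and> he e \<notin> X}"
    and "k > 0"
  shows "has_nowhere_zero_flow (Suc k) G"
proof -
  interpret multigraph G by (rule assms(1))
  let ?V = "vertices G" and ?E = "edges G"
  have "\<exists>f. (\<forall>e\<in>?E. 1 \<le> f e \<and> f e \<le> int k) \<and> (\<forall>v\<in>?V. net_outflow ?E ta he f v = 0)"
  proof (rule hoffman_circulation[OF finite_vertices finite_edges])
    show "ta ` ?E \<subseteq> ?V" "he ` ?E \<subseteq> ?V" using ends ends_subset by fastforce+
    show "sum (\<lambda>_. 0) X \<le> cut_capacity ?E ta he (\<lambda>_. 1) (\<lambda>_. int k) X" if "X \<subseteq> ?V" for X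
    proof -
      have "cut_capacity ?E ta he (\<lambda>_. 1) (\<lambda>_. int k) X
          = (\<Sum>e\<in>?E. int k * of_bool (ta e \<in> X \<and> he e \<notin> X) - of_bool (he e \<in> X \<and> ta e \<notin> X))"
        unfolding cut_capacity_def by (rule sum.cong) auto
      also have "\<dots> = int k * int (card {e \<in> ?E. ta e \<in> X \<and> he e \<notin> X})
          - int (card {e \<in> ?E. he e \<in> X \<and> ta e \<notin> X})"
        using finite_edges by (simp add: sum_subtractf sum_distrib_left[symmetric] Int_def)
      finally show ?thesis using cut[OF that] by (simp flip: of_nat_mult)
    qed
  qed (use \<open>k > 0\<close> in auto)
  then obtain f where f: "\<And>e. e \<in> ?E \<Longrightarrow> 1 \<le> f e \<and> f e \<le> int k"
    "\<And>v. v \<in> ?V \<Longrightarrow> net_outflow ?E ta he f v = 0" by blast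
  let ?D = "\<lparr>verts = ?V, arcs = ?E, tail = ta, head = he\<rparr>"
  have "(\<Sum>e\<in>out_arcs ?D v. nat (f e)) = (\<Sum>e\<in>in_arcs ?D v. nat (f e))" if "v \<in> ?V" for v
  proof -
    have cast: "int (\<Sum>e\<in>A. nat (f e)) = sum f A" if "A \<subseteq> ?E" for A
      unfolding of_nat_sum by (rule sum.cong) (use f(1) that in force)+
    have "sum f {e \<in> ?E. ta e = v} = sum f {e \<in> ?E. he e = v}"
      using f(2)[OF that] by (simp add: net_outflow_eq[OF finite_edges])
    then have "int (\<Sum>e\<in>{e \<in> ?E. ta e = v}. nat (f e)) = int (\<Sum>e\<in>{e \<in> ?E. he e = v}. nat (f e))"
      by (subst (1 2) cast) auto
    then show ?thesis by (simp add: out_arcs_def in_arcs_def del: of_nat_sum)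
  qed
  moreover have "nat (f e) < Suc k" "nat (f e) \<noteq> 0" if "e \<in> ?E" for e
    using f(1)[OF that] by auto
  ultimately have "is_flow (Suc k) G ?D (nat \<circ> f)"
    using ends by (simp add: is_flow_def orientation_def)
  then show ?thesis
    unfolding has_nowhere_zero_flow_def using \<open>\<And>e. e \<in> ?E \<Longrightarrow> nat (f e) \<noteq> 0\<close>
    by (intro exI[of _ ?D] exI[of _ "nat \<circ> f"]) simp
qed

section \<open>The flow\<close>

text \<open>The condition on cuts is the lower bound of five halves of the number of odd cycles,
  minus 1, with the fraction cleared. It holds trivially when there are no odd cycles.\<close>

lemma nowhere_zero_5_flow_of_two_factor:
  fixes G F :: "('v, 'e) mgraph"
  assumes "multigraph G" "cubic G" "two_factor G F"
    and large: "\<And>C. edge_cut G C \<Longrightarrow> separates_odd_cycles G F C \<Longrightarrow>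
      5 * card (odd_cycles F) \<le> 2 * card C + 2"
  shows "has_nowhere_zero_flow 5 G"
proof -
  let ?V = "vertices G" and ?E = "edges G" and ?M = "edges G - edges F"
  interpret multigraph G by (rule assms(1))
  obtain t\<^sub>0 h\<^sub>0 where "oriented_two_factor G F t\<^sub>0 h\<^sub>0"
    by (rule exists_oriented_two_factor[OF assms(1,3)])
  then interpret oriented_two_factor G F t\<^sub>0 h\<^sub>0 .
  obtain \<mu> where \<mu>: "\<And>v. v \<in> ?V \<Longrightarrow> \<mu> v \<in> ?V \<and> \<mu> v \<noteq> v \<and> \<mu> (\<mu> v) = v"
    and M_ends: "\<And>e v. e \<in> ?M \<Longrightarrow> v \<in> ends G e \<Longrightarrow> ends G e = {v, \<mu> v}"
    and M_one: "\<And>v. v \<in> ?V \<Longrightarrow> card {e \<in> ?M. v \<in> ends G e} = 1"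
    by (rule cubic_two_factor_partner[OF assms(1,2,3)]) blast
  obtain T U where TU: "T \<union> succ ` T \<union> U = ?V" "T \<inter> succ ` T = {}" "T \<inter> U = {}" "succ ` T \<inter> U = {}"
    and bij_U: "bij_betw (orbit succ) U {K \<in> orbit succ ` ?V. odd (card K)}"
    by (rule near_perfect_matching_of_permutation[OF succ_permutes finite_vertices])
  have UV: "U \<subseteq> ?V" and TV: "T \<subseteq> ?V" using TU(1) by blast+
  have finU: "finite U" using UV finite_vertices finite_subset by blast
  have succ_V: "succ v \<in> ?V \<longleftrightarrow> v \<in> ?V" for v by (rule permutes_in_image[OF succ_permutes])
  have "\<exists>s :: 'v \<Rightarrow> int. (\<forall>v\<in>?V. s v \<in> {1, -1} \<and> s (\<mu> v) = - s v)
      \<and> (\<forall>(x, y)\<in>(\<lambda>v. (v, succ v)) ` T. s y = - s x)"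
  proof (rule alternating_signs[OF finite_vertices \<mu>])
    show "(\<lambda>v. (v, succ v)) ` T \<subseteq> ?V \<times> ?V" using TV succ_V by auto
    show "inj_on snd ((\<lambda>v. (v, succ v)) ` T)"
      using permutes_inj[OF succ_permutes] by (auto simp: inj_on_def)
    show "fst ` (\<lambda>v. (v, succ v)) ` T \<inter> snd ` (\<lambda>v. (v, succ v)) ` T = {}"
      using TU(2) by (auto simp: image_image)
  qed (auto simp: inj_on_def)
  then obtain s :: "'v \<Rightarrow> int" where s: "\<And>v. v \<in> ?V \<Longrightarrow> s v \<in> {1, -1}"
    and s_\<mu>: "\<And>v. v \<in> ?V \<Longrightarrow> s (\<mu> v) = - s v" and s_T: "\<And>v. v \<in> T \<Longrightarrow> s (succ v) = - s v"
    by (auto simp: image_iff)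

  \<comment> \<open>Matching edges run from sign \<open>1\<close> to sign \<open>-1\<close> and cycles are oriented cyclically, so the net
    outflow at \<open>v\<close> is \<open>s v\<close>.\<close>
  have "\<exists>p. ends G e = {fst p, snd p} \<and> s (fst p) = 1 \<and> s (snd p) = -1" if e: "e \<in> ?M" for e
  proof -
    obtain v where v: "v \<in> ends G e" "v \<in> ?V"
      using card_ends[of e] ends_subset[of e] e by (force simp: card_2_iff)
    note e_ends = M_ends[OF e v(1)]
    show ?thesis
    proof (cases "s v = 1")
      case True
      then show ?thesis using e_ends s_\<mu>[OF v(2)] by (intro exI[of _ "(v, \<mu> v)"]) simp
    next
      case False
      then show ?thesis using e_ends s_\<mu>[OF v(2)] s[OF v(2)] by (intro exI[of _ "(\<mu> v, v)"]) auto
    qed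
  qed
  then obtain p where p: "\<And>e. e \<in> ?M \<Longrightarrow> ends G e = {fst (p e), snd (p e)} \<and> s (fst (p e)) = 1 \<and> s (snd (p e)) = -1"
    by metis
  define ta he where "ta e = (if e \<in> edges F then t\<^sub>0 e else fst (p e))"
    and "he e = (if e \<in> edges F then h\<^sub>0 e else snd (p e))" for e
  have ends_eq: "ends G e = {ta e, he e}" if "e \<in> ?E" for e
    using that ends[of e] p[of e] by (auto simp: ta_def he_def)

  have net: "net_outflow ?E ta he (\<lambda>_. 1) v = s v" if v: "v \<in> ?V" for v
  proof -
    have "net_outflow ?E ta he (\<lambda>_. 1) v
        = net_outflow ?M ta he (\<lambda>_. 1) v + net_outflow (edges F) ta he (\<lambda>_. 1) v"
      unfolding net_outflow_def by (rule sum.subset_diff[OF F_simps(3) finite_edges])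
    moreover have "net_outflow (edges F) ta he (\<lambda>_. 1) v = 0"
    proof -
      have "net_outflow (edges F) ta he (\<lambda>_. 1) v
          = (\<Sum>e\<in>edges F. of_bool (t\<^sub>0 e = v)) - (\<Sum>e\<in>edges F. of_bool (h\<^sub>0 e = v))"
        unfolding net_outflow_def sum_subtractf[symmetric]
        by (rule sum.cong) (auto simp: ta_def he_def)
      also have "\<dots> = 0"
        using sum.reindex_bij_betw[OF bij_tail, of "\<lambda>w. of_bool (w = v) :: int"]
          sum.reindex_bij_betw[OF bij_head, of "\<lambda>w. of_bool (w = v) :: int"] by simp
      finally show ?thesis .
    qed
    moreover have "net_outflow ?M ta he (\<lambda>_. 1) v = s v"
    proof -
      have "net_outflow ?M ta he (\<lambda>_. 1) v = (\<Sum>e\<in>?M. if v \<in> ends G e then s v else 0)"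
        unfolding net_outflow_def
        by (rule sum.cong) (use p in \<open>force simp: ta_def he_def\<close>)+
      also have "\<dots> = s v * int (card {e \<in> ?M. v \<in> ends G e})"
        using finite_edges by (simp add: sum.If_cases Int_def)
      finally show ?thesis using M_one[OF v] by simp
    qed
    ultimately show ?thesis by simp
  qed

  define P where "P X = card {e \<in> ?E. ta e \<in> X \<and> he e \<notin> X}" for X
  define Q where "Q X = card {e \<in> ?E. he e \<in> X \<and> ta e \<notin> X}" for X
  \<comment> \<open>Cycle edges leaving \<open>X\<close>, counted by their tails.\<close>
  define c where "c X = card {v \<in> ?V. v \<in> X \<and> succ v \<notin> X}" for X
  have PQ: "sum s X = int (P X) - int (Q X)" if X: "X \<subseteq> ?V" for X
  proof -
    have "sum s X = sum (net_outflow ?E ta he (\<lambda>_. 1)) X"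
      using net X by (intro sum.cong) auto
    also have "\<dots> = (\<Sum>e\<in>?E. of_bool (ta e \<in> X) - of_bool (he e \<in> X))"
      by (subst net_outflow_sum) (use X finite_vertices finite_subset in auto)
    also have "\<dots> = (\<Sum>e\<in>?E. of_bool (ta e \<in> X \<and> he e \<notin> X) - of_bool (he e \<in> X \<and> ta e \<notin> X))"
      by (rule sum.cong) auto
    also have "\<dots> = int (P X) - int (Q X)"
      using finite_edges by (simp add: sum_subtractf P_def Q_def Int_def)
    finally show ?thesis .
  qed
  have c_le_P: "c X \<le> P X" for X
    unfolding c_def P_def
  proof (rule surj_card_le)
    show "{v \<in> ?V. v \<in> X \<and> succ v \<notin> X} \<subseteq> ta ` {e \<in> ?E. ta e \<in> X \<and> he e \<notin> X}"
    proof clarify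
      fix v assume v: "v \<in> ?V" "v \<in> X" "succ v \<notin> X"
      obtain e where "e \<in> edges F" "t\<^sub>0 e = v" "h\<^sub>0 e = succ v" using edge_from[OF v(1)] .
      then show "v \<in> ta ` {e \<in> ?E. ta e \<in> X \<and> he e \<notin> X}"
        using v F_simps(3) by (intro image_eqI[of _ _ e]) (auto simp: ta_def he_def)
    qed
  qed (use finite_edges in auto)

  have sum_V: "sum s ?V = 0"
  proof -
    have "{e \<in> ?E. ta e \<in> ?V \<and> he e \<notin> ?V} = {}" "{e \<in> ?E. he e \<in> ?V \<and> ta e \<notin> ?V} = {}"
      using ends_eq ends_subset by blast+
    then have "P ?V = 0" "Q ?V = 0" unfolding P_def Q_def by (simp_all only: card.empty)
    then show ?thesis using PQ[of ?V] by simp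
  qed
  have U_split: "card U = card {u \<in> U. s u = 1} + card {u \<in> U. s u = -1}"
  proof -
    have "card U = card ({u \<in> U. s u = 1} \<union> {u \<in> U. s u = -1})"
      by (rule arg_cong[of _ _ card]) (use s UV in auto)
    also have "\<dots> = card {u \<in> U. s u = 1} + card {u \<in> U. s u = -1}"
      by (rule card_Un_disjoint) (use finU in auto)
    finally show ?thesis .
  qed
  \<comment> \<open>Over the whole vertex set the signs sum to zero and the pairs from
    \<open>T\<close> cancel, so the signs on \<open>U\<close> alone sum to zero.\<close>
  moreover have "card {u \<in> U. s u = 1} = card {u \<in> U. s u = -1}"
  proof -
    have "sum s ?V = (\<Sum>v\<in>T. s v * (of_bool (v \<in> ?V) - of_bool (succ v \<in> ?V))) + sum s (U \<inter> ?V)"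
      by (rule alternating_sum_eq[where r = s and W = ?V, OF succ_permutes finite_vertices TU s_T subset_refl])
    then have "0 = sum s U"
      using sum_V UV by (simp add: succ_V Int_absorb2)
    also have "\<dots> = (\<Sum>u\<in>U. of_bool (s u = 1) - of_bool (s u = -1))"
      by (rule sum.cong) (use s UV in force)+
    also have "\<dots> = int (card {u \<in> U. s u = 1}) - int (card {u \<in> U. s u = -1})"
      using finU by (simp add: sum_subtractf Int_def)
    finally show ?thesis by simp
  qed
  moreover have "card (odd_cycles F) = card U"
    using card_odd_cycles bij_betw_same_card[OF bij_U] by simp
  ultimately have half: "card (odd_cycles F) = 2 * card {u \<in> U. s u = -1}" by simp

  \<comment> \<open>The first bound applies \<open>alternating_sum_le\<close> to \<open>- s\<close>
    on \<open>X\<close>, the second to \<open>s\<close> on the complement, where the sum is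
    \<open>- sum s X\<close> because the total is zero. The exits of the complement are the entries
    of \<open>X\<close>, of which there are \<open>c X\<close>.\<close>
  have bound: "- sum s X \<le> 2 * int (c X) + int (card {u \<in> U. u \<in> X \<and> s u = -1})"
      "- sum s X \<le> 2 * int (c X) + int (card {u \<in> U. u \<notin> X \<and> s u = 1})"
      "c (?V - X) = c X"
    if X: "X \<subseteq> ?V" for X
  proof -
    have "(\<Sum>v\<in>X. - s v) \<le> 2 * int (card {v \<in> ?V. v \<in> X \<and> succ v \<notin> X})
        + int (card {u \<in> U \<inter> X. - s u = 1})"
      by (rule alternating_sum_le[OF succ_permutes finite_vertices TU _ X]) (use s s_T in force)+
    also have "{u \<in> U \<inter> X. - s u = 1} = {u \<in> U. u \<in> X \<and> s u = -1}" by auto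
    finally show "- sum s X \<le> 2 * int (c X) + int (card {u \<in> U. u \<in> X \<and> s u = -1})"
      by (simp add: sum_negf c_def)
    have "sum s (?V - X) \<le> 2 * int (card {v \<in> ?V. v \<in> ?V - X \<and> succ v \<notin> ?V - X})
        + int (card {u \<in> U \<inter> (?V - X). s u = 1})"
      by (rule alternating_sum_le[where r = s, OF succ_permutes finite_vertices TU s_T _ s]) auto
    also have "{u \<in> U \<inter> (?V - X). s u = 1} = {u \<in> U. u \<notin> X \<and> s u = 1}" using UV by auto
    also have exits: "card {v \<in> ?V. v \<in> ?V - X \<and> succ v \<notin> ?V - X} = c X"
      unfolding c_def card_exits_eq_card_entries[OF succ_permutes finite_vertices X, symmetric]
      by (rule arg_cong[of _ _ card]) (use succ_V in auto)
    finally show "- sum s X \<le> 2 * int (c X) + int (card {u \<in> U. u \<notin> X \<and> s u = 1})"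
      using sum_V X finite_vertices by (simp add: sum_diff)
    show "c (?V - X) = c X" using exits by (simp add: c_def)
  qed
  have split_le: "card A \<le> c X" if "A \<subseteq> U" "A \<subseteq> X" "X \<subseteq> ?V" "\<And>u. u \<in> A \<Longrightarrow> \<not> orbit succ u \<subseteq> X" for A X
    unfolding c_def
    by (rule card_split_orbits_le_exits[OF succ_permutes finite_vertices])
      (use that bij_U in \<open>auto simp: bij_betw_def intro: inj_on_subset\<close>)

  have "Q X \<le> 4 * P X" if X: "X \<subseteq> ?V" for X
  proof -
    consider "\<And>u. u \<in> U \<Longrightarrow> u \<in> X \<Longrightarrow> s u = -1 \<Longrightarrow> \<not> orbit succ u \<subseteq> X"
      | "\<And>w. w \<in> U \<Longrightarrow> w \<notin> X \<Longrightarrow> s w = 1 \<Longrightarrow> \<not> orbit succ w \<subseteq> ?V - X"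
      | u w where "u \<in> U" "u \<in> X" "orbit succ u \<subseteq> X" "w \<in> U" "w \<notin> X" "orbit succ w \<subseteq> ?V - X"
      by blast
    then show ?thesis
    proof cases
      case 1
      have "card {u \<in> U. u \<in> X \<and> s u = -1} \<le> c X"
        by (rule split_le) (use 1 X in auto)
      then show ?thesis using bound(1)[OF X] PQ[OF X] c_le_P[of X] by linarith
    next
      case 2
      have "card {u \<in> U. u \<notin> X \<and> s u = 1} \<le> c (?V - X)"
        by (rule split_le) (use 2 UV in auto)
      then show ?thesis using bound(2,3)[OF X] PQ[OF X] c_le_P[of X] by linarith
    next
      case (3 u w)
      let ?C = "{e \<in> ?E. ends G e \<inter> X \<noteq> {} \<and> ends G e - X \<noteq> {}}"
      have odd: "odd (card (orbit succ x))" if "x \<in> U" for x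
        using bij_U that by (auto simp: bij_betw_def)
      have "edge_cut G ?C"
        unfolding edge_cut_def using X 3 UV by (intro exI[of _ X]) auto
      moreover have "separates_odd_cycles G F ?C"
        by (rule cut_separates_odd_cycles[of u _ w]) (use 3 UV odd in auto)
      ultimately have "5 * card (odd_cycles F) \<le> 2 * card ?C + 2" by (rule large)
      moreover have "card ?C = P X + Q X"
      proof -
        have "card ?C = card ({e \<in> ?E. ta e \<in> X \<and> he e \<notin> X} \<union> {e \<in> ?E. he e \<in> X \<and> ta e \<notin> X})"
          by (rule arg_cong[of _ _ card]) (use ends_eq in auto)
        also have "\<dots> = P X + Q X"
          unfolding P_def Q_def by (rule card_Un_disjoint) (use finite_edges in auto)
        finally show ?thesis .
      qed
      moreover have "card {u \<in> U. u \<in> X \<and> s u = -1} \<le> card {u \<in> U. s u = -1}"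
        using finU by (intro card_mono) auto
      \<comment> \<open>Let p, q be \<open>P X\<close>, \<open>Q X\<close> and t the number of
        negative vertices in \<open>U\<close>. From 10 t \<le> 2 (p + q) + 2 and q \<le> 3 p + t
        follows 4 t - 1 \<le> 4 p, so t \<le> p by integrality and q \<le> 4 p.\<close>
      ultimately show ?thesis
        using bound(1)[OF X] PQ[OF X] c_le_P[of X] half by linarith
    qed
  qed
  then have "has_nowhere_zero_flow (Suc 4) G"
    by (intro has_nowhere_zero_flowI[OF assms(1) ends_eq]) (simp_all add: P_def Q_def)
  then show ?thesis by (simp add: eval_nat_numeral)
qed

section \<open>From the extremal parameters to a single 2-factor\<close>

text \<open>If no element reaches \<open>n\<close>, then \<open>n - 1\<close> is an upper bound.
  Positivity of \<open>n\<close> keeps the subtraction exact and excludes the empty set, whose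
  supremum is 0.\<close>

lemma enat_le_SupD:
  assumes "enat n \<le> Sup A" "0 < n"
  shows "\<exists>x\<in>A. enat n \<le> x"
proof (rule ccontr)
  assume "\<not> ?thesis"
  then have "x \<le> enat (n - 1)" if "x \<in> A" for x
    using that assms(2) by (cases x) force+
  then have "Sup A \<le> enat (n - 1)" by (rule Sup_least)
  with assms show False by (metis Suc_diff_1 Suc_ile_eq enat_ord_simps(2) lessI order.strict_trans2 not_less)
qed

theorem theorem2:
  fixes G :: "('v, 'e) mgraph"
  assumes "multigraph G"
    and "cubic G"
    and "bridgeless G"
    and "ereal_of_enat (m_star G) \<ge> 5 / 2 * ereal_of_enat (oddness G) - 1"
  shows "has_nowhere_zero_flow 5 G"
proof -
  \<comment> \<open>Without a 2-factor, oddness is an empty infimum and \<open>m_star G\<close> an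
    empty supremum, and the hypothesis would read 0 \<ge> \<infinity>.\<close>
  have "{F. two_factor G F} \<noteq> {}"
  proof
    assume none: "{F. two_factor G F} = {}"
    then have "oddness G = \<infinity>" "m_star G = 0"
      by (simp_all add: oddness_def m_star_def minimum_two_factor_def top_enat_def bot_enat_def)
    with assms(4) show False by simp
  qed
  then have "(\<lambda>F. enat (card (odd_cycles F))) ` {F. two_factor G F} \<noteq> {}" by blast
  then have "oddness G \<in> (\<lambda>F. enat (card (odd_cycles F))) ` {F. two_factor G F}"
    unfolding oddness_def by (metis Inf_enat_def LeastI_ex ex_in_conv)
  then obtain F\<^sub>0 where F\<^sub>0: "two_factor G F\<^sub>0" "oddness G = enat (card (odd_cycles F\<^sub>0))" by blast
  show ?thesis
  proof (cases "card (odd_cycles F\<^sub>0) = 0")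
    case True
    then show ?thesis
      by (intro nowhere_zero_5_flow_of_two_factor[OF assms(1,2) F\<^sub>0(1)]) simp
  next
    case False
    define w where "w = card (odd_cycles F\<^sub>0)"
    \<comment> \<open>The least integer that is at least five halves of \<open>w\<close> minus
      1.\<close>
    define n where "n = (5 * w - 1) div 2"
    have w: "0 < w" "oddness G = enat w" using False F\<^sub>0 by (auto simp: w_def)
    then have n: "0 < n" "5 * w \<le> 2 * n + 2" by (auto simp: n_def)
    have "enat n \<le> m_star G"
    proof (cases "m_star G")
      case (enat k)
      then have "5 / 2 * real w - 1 \<le> real k"
        using assms(4) by (simp add: w one_ereal_def)
      then have "5 * w \<le> 2 * k + 2" by linarith
      then show ?thesis using w enat by (simp add: n_def)
    qed simp
    \<comment> \<open>Two suprema are unfolded in turn: the one over minimum 2-factors yields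
      \<open>F\<close>, the one over admissible cut sizes yields some
      \<open>k \<ge> n\<close>.\<close>
    then obtain F where F: "minimum_two_factor G F" "enat n \<le> m_of G F"
      using enat_le_SupD[OF _ n(1)] unfolding m_star_def by blast
    have "enat n \<le> Sup {enat k | k. \<not> (\<exists>C. edge_cut G C \<and> card C < k \<and> separates_odd_cycles G F C)}"
      using F(2) w by (simp add: m_of_def zero_enat_def)
    from enat_le_SupD[OF this n(1)]
    obtain k where k: "n \<le> k" "\<not> (\<exists>C. edge_cut G C \<and> card C < k \<and> separates_odd_cycles G F C)"
      by auto
    show ?thesis
    proof (rule nowhere_zero_5_flow_of_two_factor[OF assms(1,2)])
      show "two_factor G F" using F(1) by (simp add: minimum_two_factor_def)
      fix C assume "edge_cut G C" "separates_odd_cycles G F C"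
      then have "k \<le> card C" using k(2) by force
      moreover have "card (odd_cycles F) = w" using F(1) w by (simp add: minimum_two_factor_def)
      ultimately show "5 * card (odd_cycles F) \<le> 2 * card C + 2" using n(2) k(1) by simp
    qed
  qed
qed

end
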